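(* Let $f$ be a meromorphic function on $\mathbb{C}$ of finite order $\sigma$ such that $f\notin\ker\mathcal{D}_{\mathrm{W}}$, let $q$ be a positive integer, and let $y_1,\ldots,y_q$ be $q$ distinct complex numbers. Then for every $\varepsilon>0$, $$m(r,f)+\sum_{n=1}^q m\left(r,\frac{1}{f-y_n}\right)\le 2T(r,f)-N_{\mathrm{W}}(r)+O(r^{\sigma-\frac12+\varepsilon})+O(1)$$ as $r\to\infty$, where $$N_{\mathrm{W}}(r):=N\left(r,\frac{1}{\mathcal{D}_{\mathrm{W}}f}\right)+2N(r,f)-N(r,\mathcal{D}_{\mathrm{W}}f).$$
   Context: The Wilson operator $\mathcal{D}_{\mathrm{W}}$: for $x\ne0$ and $z$ with $z^2=x$, $$(\mathcal{D}_{\mathrm{W}}f)(x):=\frac{f((z+\frac i2)^2)-f((z-\frac i2)^2)}{2iz},$$ which does not depend on the choice of $z$; at $x=0$ the value is the limit as $x\to0$, which is $f'(-\frac14)$ if $f$ is differentiable at $-\frac14$. If $f$ is meromorphic on $\mathbb{C}$, so is $\mathcal{D}_{\mathrm{W}}f$. $\ker\mathcal{D}_{\mathrm{W}}$ is the set of functions $f$ with $\mathcal{D}_{\mathrm{W}}f\equiv0$. Nevanlinna notation: for a meromorphic $f\not\equiv0$ and $r>0$, $m(r,f)=\frac1{2\pi}\int_0^{2\pi}\ln^+|f(re^{i\theta})|\,d\theta$; $n(r,f)$ is the number of poles of $f$ in $|x|\le r$ counted with multiplicity; $N(r,f)=\int_0^r\frac{n(t,f)-n(0,f)}{t}dt+n(0,f)\ln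 r$; $T(r,f)=m(r,f)+N(r,f)$. The order of $f$ is $\limsup_{r\to\infty}\frac{\ln^+T(r,f)}{\ln r}$. *)

theory Defs
  imports "HOL-Complex_Analysis.Complex_Analysis" "HOL-Library.Landau_Symbols"
begin

definition wilson_quotient :: "(complex \<Rightarrow> complex) \<Rightarrow> complex \<Rightarrow> complex" where
  "wilson_quotient f z = (f ((z + \<i> / 2)\<^sup>2) - f ((z - \<i> / 2)\<^sup>2)) / (2 * \<i> * z)"

text \<open>\<open>csqrt\<close> merely fixes one of the two roots; by \<open>wilson_eq_quotient\<close> below any root gives the
  same value.\<close>

definition wilson :: "(complex \<Rightarrow> complex) \<Rightarrow> complex \<Rightarrow> complex" where
  "wilson f x = (if x = 0 then Lim (at 0) (\<lambda>w. wilson_quotient f (csqrt w))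
                 else wilson_quotient f (csqrt x))"

lemma wilson_quotient_minus: "wilson_quotient f (- z) = wilson_quotient f z"
proof -
  have "(- z + \<i> / 2)\<^sup>2 = (z - \<i> / 2)\<^sup>2" "(- z - \<i> / 2)\<^sup>2 = (z + \<i> / 2)\<^sup>2"
    by (simp_all add: power2_eq_square algebra_simps)
  then show ?thesis
    by (cases "z = 0") (simp_all add: wilson_quotient_def field_simps)
qed

lemma wilson_eq_quotient:
  assumes "x \<noteq> 0" and "z\<^sup>2 = x"
  shows "wilson f x = wilson_quotient f z"
proof -
  have "csqrt x = z \<or> csqrt x = - z"
    using assms(2) by (metis power2_csqrt power2_eq_iff)
  then show ?thesis
    using assms(1) by (auto simp: wilson_def wilson_quotient_minus)
qed

text \<open>A meromorphic function is represented by a total function whose values on a discrete closed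
  set (such as its poles) carry no information, so the identity \<open>wilson f \<equiv> 0\<close> between meromorphic
  functions is an identity outside such a set.  In particular, changing the arbitrary values of
  \<open>f\<close> at its poles does not move \<open>f\<close> into or out of the kernel.\<close>

definition wilson_kernel :: "(complex \<Rightarrow> complex) set" where
  "wilson_kernel = {f. eventually (\<lambda>x. wilson f x = 0) (cosparse UNIV)}"

definition ln_plus :: "real \<Rightarrow> real" where
  "ln_plus x = (if x \<le> 1 then 0 else ln x)"

definition proximity :: "real \<Rightarrow> (complex \<Rightarrow> complex) \<Rightarrow> real" where
  "proximity r f =
     1 / (2 * pi) * integral {0..2 * pi} (\<lambda>\<theta>. ln_plus (cmod (f (complex_of_real r * exp (\<i> * complex_of_real \<theta>)))))"

text \<open>At a pole \<open>z\<close>, \<open>zorder f z\<close> is minus the multiplicity.\<close>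

definition pole_count :: "real \<Rightarrow> (complex \<Rightarrow> complex) \<Rightarrow> real" where
  "pole_count r f = (\<Sum>z | cmod z \<le> r \<and> is_pole f z. real_of_int (- zorder f z))"

definition integrated_pole_count :: "real \<Rightarrow> (complex \<Rightarrow> complex) \<Rightarrow> real" where
  "integrated_pole_count r f =
     integral {0..r} (\<lambda>t. (pole_count t f - pole_count 0 f) / t) + pole_count 0 f * ln r"

definition nevanlinna_char :: "real \<Rightarrow> (complex \<Rightarrow> complex) \<Rightarrow> real" where
  "nevanlinna_char r f = proximity r f + integrated_pole_count r f"

definition growth_order :: "(complex \<Rightarrow> complex) \<Rightarrow> ereal" where
  "growth_order f = Limsup at_top (\<lambda>r::real. ereal (ln_plus (nevanlinna_char r f) / ln r))"

definition wilson_ramification :: "real \<Rightarrow> (complex \<Rightarrow> complex) \<Rightarrow> real" where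
  "wilson_ramification r f =
     integrated_pole_count r (\<lambda>x. 1 / wilson f x) + 2 * integrated_pole_count r f
       - integrated_pole_count r (wilson f)"

end

theory Submission
  imports Defs
begin

text \<open>
  Where \<open>D = wilson f\<close> does not vanish, at most one of the \<open>y n\<close> is close to \<open>f\<close>, hence
  \<open>\<Sum> ln\<^sup>+ (1/|f - y n|) \<le> \<Sum> ln\<^sup>+ |D/(f - y n)| + ln\<^sup>+ (1/|D|) + O(1)\<close>, while
  \<open>m(r, D) \<le> m(r, f) + m(r, D/f)\<close>.  Jensen's formula for \<open>D\<close> trades \<open>m(r, 1/D)\<close> for
  \<open>m(r, D) + N(r, D) - N(r, 1/D) + O(1)\<close>, and the inequality follows once \<open>m(r, D/(f - c))\<close>
  is known to be \<open>O(r powr (\<sigma> - 1/2 + \<epsilon>))\<close>.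

  For that estimate, write \<open>f = exp G \<cdot> \<Prod> (w - a)^k\<close> on a disc of radius \<open>5r\<close> and put \<open>w = z\<^sup>2\<close> with
  \<open>|z| = sqrt r\<close>.  The shift from \<open>z\<^sup>2\<close> to \<open>(z \<plusminus> \<i>/2)\<^sup>2\<close> has length \<open>O(sqrt r)\<close>, so that Schwarz's
  formula for \<open>G'\<close> gives a gain of \<open>r powr -(1/2)\<close> over \<open>m(4r, f) + m(4r, 1/f)\<close>.  With \<open>a = b\<^sup>2\<close> each
  factor splits as \<open>(z - b) (z + b)\<close>, and \<open>ln (1 + t) = O(t powr \<alpha>)\<close> together with the uniform
  bound \<open>O(s powr -\<alpha>)\<close> for the mean of \<open>|z - b| powr -\<alpha>\<close> over \<open>|z| = s\<close>, where \<open>\<alpha> < 1\<close>, gains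
  \<open>r powr -(\<alpha>/2)\<close> per zero or pole.
\<close>

section \<open>Circle means with logarithmic and power singularities\<close>

text \<open>In the variable \<open>w\<close> the shift has length about \<open>sqrt r\<close>, too
  long to compare a factor \<open>w - a\<close> with its shifted value near a zero or pole. In
  \<open>z\<close> the shift has length 1/2 everywhere, which is why the comparison is made there.
  As \<theta> runs over [0, 2 pi], \<open>rcis (sqrt r) (\<theta> / 2)\<close> covers half a circle
  while its square covers the circle of radius \<open>r\<close> once; so the singular integrals are
  needed for half angles too.

  The exponent \<alpha> must stay below 1 because the reciprocal distance to a point of a circle is
  not integrable over that circle; this causes the loss of \<epsilon>. Finite order enters as a
  bound by a power of \<open>r\<close>, which changes only by a constant factor when
  \<open>r\<close> is replaced by \<open>4 * r\<close>, \<open>5 * r\<close> or their doubles. Hence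
  the estimate holds for all large \<open>r\<close>, without an exceptional set of radii.\<close>

abbreviation angles :: "real measure" where
  "angles \<equiv> restrict_space lborel {0..2 * pi}"

lemma finite_measure_angles [simp]: "finite_measure angles"
  by (rule finite_measureI) (auto simp: emeasure_restrict_space space_restrict_space)

lemma measure_angles [simp]: "measure angles {0..2 * pi} = 2 * pi"
  by (subst measure_restrict_space) auto

lemma integrable_angles_const [simp]: "integrable angles (\<lambda>_. c :: real)"
  by (rule finite_measure.integrable_const[OF finite_measure_angles])

lemma integral_angles_const [simp]: "(LINT \<theta>|angles. c :: real) = 2 * pi * c"
  by (simp add: space_restrict_space)

text \<open>\<open>proximity\<close> is defined by a gauge integral, whereas domination and almost
  everywhere arguments are made for Lebesgue integrals; this passes between the two.\<close>

lemma integral_angles_eq: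
  fixes u :: "real \<Rightarrow> 'a::euclidean_space"
  assumes "integrable angles u"
  shows "integral {0..2 * pi} u = (LINT \<theta>|angles. u \<theta>)"
proof -
  have "set_integrable lborel {0..2 * pi} u"
    using assms by (subst (asm) integrable_restrict_space) (auto simp: set_integrable_def)
  from set_borel_integral_eq_integral(2)[OF this] show ?thesis
    by (subst integral_restrict_space) (auto simp: set_lebesgue_integral_def)
qed

lemma integrable_angles_continuous:
  fixes u :: "real \<Rightarrow> 'a::euclidean_space"
  assumes "continuous_on {0..2 * pi} u"
  shows "integrable angles u"
  using borel_integrable_atLeastAtMost'[OF assms]
  by (subst integrable_restrict_space) (auto simp: set_integrable_def)

lemma AE_angles_finite:
  assumes "finite {\<theta> \<in> {0..2 * pi}. \<not> P \<theta>}"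
  shows "AE \<theta> in angles. P \<theta>"
proof -
  have "AE \<theta> in lborel. \<theta> \<notin> {\<theta> \<in> {0..2 * pi}. \<not> P \<theta>}"
    by (rule AE_not_in, rule finite_imp_null_set_lborel, rule assms)
  thus ?thesis
    by (subst AE_restrict_space_iff) (auto elim!: eventually_mono)
qed

lemma borel_measurable_angles:
  "u \<in> borel_measurable borel \<Longrightarrow> u \<in> borel_measurable angles"
  by (rule measurable_restrict_space1) simp

section \<open>Negative powers of the sine and of distances on a circle\<close>

lemma sin_ge_half:
  fixes x :: real
  assumes "0 \<le> x" "x \<le> pi / 2"
  shows "sin x \<ge> x / 2"
proof -
  \<comment> \<open>Since 1.6 * 1.6 / 6 < 1/2, the cubic Taylor remainder is at most half of
    \<open>x\<close>.\<close>
  have "x \<le> 1.6" using assms pi_approx by simp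
  hence "x * x \<le> 1.6 * 1.6" using assms by (intro mult_mono) auto
  hence "x * (x * x) \<le> x * (1.6 * 1.6)" using assms by (intro mult_left_mono) auto
  moreover have "\<bar>sin x - (\<Sum>m<3. sin_coeff m * x ^ m)\<bar> \<le> inverse (fact 3) * \<bar>x\<bar> ^ 3"
    by (rule Maclaurin_sin_bound)
  hence "\<bar>sin x - x\<bar> \<le> x * (x * x) / 6"
    using assms by (simp add: numeral_eq_Suc sin_coeff_def)
  ultimately show ?thesis using assms by (simp only: abs_le_iff) linarith
qed

lemma abs_sin_eq:
  fixes u :: real
  assumes "\<bar>u\<bar> \<le> pi"
  shows "\<bar>sin u\<bar> = sin \<bar>u\<bar>"
  using sin_ge_zero[of "\<bar>u\<bar>"] assms by (cases "u \<ge> 0") auto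

text \<open>The nearest multiple of pi is at distance at most pi / 2, where
  \<open>sin_ge_half\<close> applies. The range 4 pi is that of \<open>\<theta> - \<psi>\<close> for
  \<theta> in [0, 2 pi] and |\<psi>| \<le> 2 pi, so nine multiples serve every \<psi>.\<close>

lemma abs_sin_ge_dist_pi:
  fixes t :: real
  assumes "\<bar>t\<bar> \<le> 4 * pi"
  obtains k :: int where "k \<in> {-4..4}" "\<bar>sin t\<bar> \<ge> \<bar>t - k * pi\<bar> / 2"
proof
  define k where "k = round (t / pi)"
  have k: "\<bar>k - t / pi\<bar> \<le> 1 / 2" unfolding k_def by (rule of_int_round_abs_le)
  have "\<bar>t / pi\<bar> \<le> 4" using assms by (simp add: abs_divide pos_divide_le_eq)
  with k have "\<bar>real_of_int k\<bar> < 5" by linarith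
  thus "k \<in> {-4..4}" by auto
  have "\<bar>t - k * pi\<bar> = pi * \<bar>k - t / pi\<bar>"
    by (simp add: abs_if field_simps)
  hence d: "\<bar>t - k * pi\<bar> \<le> pi / 2" using k by (simp add: mult_left_mono[of _ "1/2" pi, simplified])
  have s: "sin (real_of_int k * pi) = 0" by (simp add: sin_times_pi_eq_0)
  have "\<bar>sin t\<bar> = \<bar>sin (t - k * pi)\<bar>"
    using sin_zero_abs_cos_one[OF s] by (simp add: sin_diff abs_mult s)
  also have "\<dots> = sin \<bar>t - k * pi\<bar>"
    using abs_sin_eq d pi_gt_zero by (smt (verit) field_sum_of_halves)
  finally show "\<bar>sin t\<bar> \<ge> \<bar>t - k * pi\<bar> / 2" using sin_ge_half[of "\<bar>t - k * pi\<bar>"] d by simp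
qed

lemma integrable_abs_powr:
  fixes a L :: real
  assumes "0 < a" "a < 1" "L \<ge> 0"
  shows "integrable lborel (\<lambda>x. indicator {-L..L} x * \<bar>x\<bar> powr - a)"
proof -
  have "(\<lambda>x. x powr - a) integrable_on {0..L}"
    by (rule integrable_on_powr_from_0) (use assms in auto)
  hence 1: "(\<lambda>x. \<bar>x\<bar> powr - a) integrable_on {0..L}"
    by (rule integrable_eq) auto
  have "(\<lambda>x. \<bar>- x\<bar> powr - a) integrable_on {-L..-0}"
    using 1 by (subst Henstock_Kurzweil_Integration.integrable_reflect_real[of "\<lambda>x. \<bar>x\<bar> powr - a"])
  hence 2: "(\<lambda>x. \<bar>x\<bar> powr - a) integrable_on {-L..0}" by simp
  have "(\<lambda>x. \<bar>x\<bar> powr - a) integrable_on {-L..L}"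
    by (rule Henstock_Kurzweil_Integration.integrable_combine[OF _ _ 2 1]) (use assms in auto)
  hence "(\<lambda>x. \<bar>x\<bar> powr - a) absolutely_integrable_on {-L..L}"
    by (rule nonnegative_absolutely_integrable_1) auto
  hence "integrable lebesgue (\<lambda>x. indicator {-L..L} x * \<bar>x\<bar> powr - a)"
    by (simp add: set_integrable_def)
  thus ?thesis
    by (subst (asm) integrable_completion) auto
qed

text \<open>A sum of nine translates of one integrable kernel dominates, one for each zero of the
  sine that can matter. Integrating the translates over the whole line makes the bound independent
  of \<open>\<psi>\<close>.\<close>

lemma sin_powr_integral_bound:
  fixes a :: real
  assumes "0 < a" "a < 1"
  obtains C where "C \<ge> 0"
    "\<And>\<psi>. \<bar>\<psi>\<bar> \<le> 2 * pi \<Longrightarrow> integrable angles (\<lambda>\<theta>. \<bar>sin (\<theta> - \<psi>)\<bar> powr - a)"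
    "\<And>\<psi>. \<bar>\<psi>\<bar> \<le> 2 * pi \<Longrightarrow> (LINT \<theta>|angles. \<bar>sin (\<theta> - \<psi>)\<bar> powr - a) \<le> C"
proof -
  \<comment> \<open>The arguments \<open>\<theta> - \<psi> - j * pi\<close> that occur are at most 8
    pi in absolute value, so the cut-off at 10 pi never removes them.\<close>
  define K where "K = (\<lambda>x. indicator {-(10*pi)..10*pi} x * \<bar>x\<bar> powr - a)"
  have K: "integrable lborel K"
    unfolding K_def by (rule integrable_abs_powr) (use assms in auto)
  have K0: "K x \<ge> 0" for x by (simp add: K_def)
  define g where "g = (\<lambda>\<psi> \<theta>. 2 powr a * (\<Sum>j\<in>{-4..4::int}. K (\<theta> - \<psi> - j * pi)))"
  have intK: "integrable lborel (\<lambda>\<theta>. K (\<theta> - c))" "(LINT \<theta>|lborel. K (\<theta> - c)) = (LINT \<theta>|lborel. K \<theta>)" for c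
    using lborel_integrable_real_affine[OF K, of 1 "-c"] lborel_integral_real_affine[of 1 K "-c"]
    by simp_all
  have g: "integrable lborel (g \<psi>)" for \<psi>
    unfolding g_def using intK(1)[of "\<psi> + _ * pi"]
    by (intro integrable_mult_right integrable_sum) (simp add: diff_diff_eq)
  have g': "(LINT \<theta>|lborel. g \<psi> \<theta>) = 2 powr a * (9 * (LINT \<theta>|lborel. K \<theta>))" for \<psi>
    unfolding g_def using intK[of "\<psi> + _ * pi"]
    by (subst integral_mult_right_zero, subst Bochner_Integration.integral_sum) (simp_all add: diff_diff_eq)
  have g0: "g \<psi> \<theta> \<ge> 0" for \<psi> \<theta> unfolding g_def by (intro mult_nonneg_nonneg sum_nonneg K0) auto
  have garc: "integrable angles (g \<psi>)" for \<psi>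
    using integrable_mult_indicator[OF _ g[of \<psi>], of "{0..2*pi}"] by (subst integrable_restrict_space) auto
  have garc': "(LINT \<theta>|angles. g \<psi> \<theta>) \<le> (LINT \<theta>|lborel. g \<psi> \<theta>)" for \<psi>
    using integrable_mult_indicator[OF _ g[of \<psi>], of "{0..2*pi}"]
    by (subst integral_restrict_space) (auto intro!: integral_mono g simp: g0 indicator_def)
  have le: "\<bar>sin (\<theta> - \<psi>)\<bar> powr - a \<le> g \<psi> \<theta>" if \<psi>: "\<bar>\<psi>\<bar> \<le> 2 * pi" and \<theta>: "\<theta> \<in> {0..2*pi}" for \<psi> \<theta>
  proof -
    have t: "\<bar>\<theta> - \<psi>\<bar> \<le> 4 * pi" using \<psi> \<theta> by auto
    then obtain k :: int where k: "k \<in> {-4..4}" "\<bar>sin (\<theta> - \<psi>)\<bar> \<ge> \<bar>\<theta> - \<psi> - k * pi\<bar> / 2"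
      by (rule abs_sin_ge_dist_pi)
    have "\<bar>sin (\<theta> - \<psi>)\<bar> powr - a \<le> 2 powr a * \<bar>\<theta> - \<psi> - k * pi\<bar> powr - a"
    \<comment> \<open>At a zero of the sine the left side is \<open>0 powr - a\<close>, which is 0
      by convention.\<close>
    proof (cases "\<theta> - \<psi> - k * pi = 0")
      case True
      hence "\<theta> - \<psi> = k * pi" by simp
      hence "sin (\<theta> - \<psi>) = 0" by (simp add: sin_times_pi_eq_0)
      thus ?thesis by simp
    next
      case False
      hence "\<bar>sin (\<theta> - \<psi>)\<bar> powr - a \<le> (\<bar>\<theta> - \<psi> - k * pi\<bar> / 2) powr - a"
        using k assms by (intro powr_mono2') auto
      also have "\<dots> = 2 powr a * \<bar>\<theta> - \<psi> - k * pi\<bar> powr - a"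
        by (simp add: powr_divide powr_minus field_simps)
      finally show ?thesis .
    qed
    also have "\<bar>\<theta> - \<psi> - k * pi\<bar> powr - a = K (\<theta> - \<psi> - k * pi)"
    proof -
      have "\<bar>k * pi\<bar> \<le> 4 * pi" using k(1) by (auto simp: abs_mult)
      thus ?thesis using t unfolding K_def by (auto simp: indicator_def)
    qed
    also have "\<dots> \<le> (\<Sum>j\<in>{-4..4::int}. K (\<theta> - \<psi> - j * pi))"
      using k(1) by (intro member_le_sum K0) auto
    finally show ?thesis unfolding g_def by simp
  qed
  show ?thesis
  proof
    show "2 powr a * (9 * (LINT \<theta>|lborel. K \<theta>)) \<ge> 0"
      using K0 by (intro mult_nonneg_nonneg integral_nonneg_AE) auto
    fix \<psi> :: real assume \<psi>: "\<bar>\<psi>\<bar> \<le> 2 * pi"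
    show int: "integrable angles (\<lambda>\<theta>. \<bar>sin (\<theta> - \<psi>)\<bar> powr - a)"
    proof (rule Bochner_Integration.integrable_bound[OF garc])
      show "AE \<theta> in angles. norm (\<bar>sin (\<theta> - \<psi>)\<bar> powr - a) \<le> norm (g \<psi> \<theta>)"
        by (rule AE_I2) (use le[OF \<psi>] g0 in \<open>auto simp: space_restrict_space\<close>)
    qed (intro borel_measurable_angles, measurable)
    have "(LINT \<theta>|angles. \<bar>sin (\<theta> - \<psi>)\<bar> powr - a) \<le> (LINT \<theta>|angles. g \<psi> \<theta>)"
      by (intro integral_mono int garc) (use le[OF \<psi>] in \<open>auto simp: space_restrict_space\<close>)
    thus "(LINT \<theta>|angles. \<bar>sin (\<theta> - \<psi>)\<bar> powr - a) \<le> 2 powr a * (9 * (LINT \<theta>|lborel. K \<theta>))"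
      using garc'[of \<psi>] g'[of \<psi>] by simp
  qed
qed

text \<open>The right-hand side is the distance from the point on the circle to the line through \<open>0\<close> and
  \<open>a\<close>; it makes all bounds below uniform in \<open>a\<close>.\<close>

lemma norm_rcis_diff_ge:
  assumes "r \<ge> 0"
  shows "cmod (rcis r \<theta> - a) \<ge> r * \<bar>sin (\<theta> - Arg a)\<bar>"
proof -
  have a: "a = rcis (cmod a) (Arg a)" by (simp add: rcis_cmod_Arg)
  have "r * sin (\<theta> - Arg a) = Im ((rcis r \<theta> - a) * cis (- Arg a))"
    by (subst (2) a) (simp add: rcis_def sin_diff algebra_simps)
  also have "\<bar>\<dots>\<bar> \<le> cmod ((rcis r \<theta> - a) * cis (- Arg a))" by (rule abs_Im_le_cmod)
  also have "\<dots> = cmod (rcis r \<theta> - a)" by (simp add: norm_mult)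
  finally show ?thesis using assms by (simp add: abs_mult)
qed

lemma finite_sin_zero:
  assumes "\<bar>\<psi>\<bar> \<le> 2 * pi"
  shows "finite {\<theta> \<in> {0..2 * pi}. sin (\<theta> - \<psi>) = 0}"
proof (rule finite_subset)
  show "{\<theta> \<in> {0..2 * pi}. sin (\<theta> - \<psi>) = 0} \<subseteq> (\<lambda>k::int. \<psi> + k * pi) ` {-4..4}"
  proof
    fix \<theta> assume \<theta>: "\<theta> \<in> {\<theta> \<in> {0..2 * pi}. sin (\<theta> - \<psi>) = 0}"
    hence "\<bar>\<theta> - \<psi>\<bar> \<le> 4 * pi" using assms by auto
    then obtain k :: int where k: "k \<in> {-4..4}" "\<bar>sin (\<theta> - \<psi>)\<bar> \<ge> \<bar>\<theta> - \<psi> - k * pi\<bar> / 2"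
      by (rule abs_sin_ge_dist_pi)
    with \<theta> have "\<theta> = \<psi> + k * pi" by simp
    with k show "\<theta> \<in> (\<lambda>k::int. \<psi> + k * pi) ` {-4..4}" by blast
  qed
qed auto

lemma AE_sin_nonzero:
  "\<bar>\<psi>\<bar> \<le> 2 * pi \<Longrightarrow> AE \<theta> in angles. sin (\<theta> - \<psi>) \<noteq> 0"
  using finite_sin_zero by (intro AE_angles_finite) auto

lemma abs_Arg_le: "\<bar>Arg b\<bar> \<le> pi"
  using Arg_bounded[of b] by auto

lemma rcis_measurable [measurable]: "rcis r \<in> borel_measurable borel"
  by (intro borel_measurable_continuous_onI) (auto simp: rcis_def intro!: continuous_intros)

lemma AE_rcis_neq:
  assumes "r > 0"
  shows "AE \<theta> in angles. rcis r \<theta> \<noteq> b"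
proof -
  have "\<bar>Arg b\<bar> \<le> 2 * pi" using abs_Arg_le[of b] pi_gt_zero by linarith
  from AE_sin_nonzero[OF this] show ?thesis
  proof eventually_elim
    case (elim \<theta>)
    have "0 < r * \<bar>sin (\<theta> - Arg b)\<bar>" using elim assms by simp
    also have "\<dots> \<le> cmod (rcis r \<theta> - b)" using assms by (intro norm_rcis_diff_ge) simp
    finally show ?case by auto
  qed
qed

text \<open>The distance to the line through 0 and \<open>b\<close> reduces this to the sine kernel,
  and scaling gives the factor \<open>r powr - a\<close>. The half-angle versions serve square roots
  of points on a circle: the double-angle formula leads back to the same kernel, with
  \<open>2 * Arg b\<close> in place of \<open>Arg b\<close>.\<close>

lemma circle_powr_bound:
  fixes a :: real
  assumes "0 < a" "a < 1"
  obtains C where "C \<ge> 0"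
    "\<And>r b. r > 0 \<Longrightarrow> integrable angles (\<lambda>\<theta>. cmod (rcis r \<theta> - b) powr - a)"
    "\<And>r b. r > 0 \<Longrightarrow> (LINT \<theta>|angles. cmod (rcis r \<theta> - b) powr - a) \<le> C * r powr - a"
    "\<And>r b. r > 0 \<Longrightarrow> integrable angles (\<lambda>\<theta>. cmod (rcis r (\<theta> / 2) - b) powr - a)"
    "\<And>r b. r > 0 \<Longrightarrow> (LINT \<theta>|angles. cmod (rcis r (\<theta> / 2) - b) powr - a) \<le> C * r powr - a"
proof -
  obtain C where C: "C \<ge> 0"
    "\<And>\<psi>. \<bar>\<psi>\<bar> \<le> 2 * pi \<Longrightarrow> integrable angles (\<lambda>\<theta>. \<bar>sin (\<theta> - \<psi>)\<bar> powr - a)"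
    "\<And>\<psi>. \<bar>\<psi>\<bar> \<le> 2 * pi \<Longrightarrow> (LINT \<theta>|angles. \<bar>sin (\<theta> - \<psi>)\<bar> powr - a) \<le> C"
    using sin_powr_integral_bound[OF assms] by blast
  \<comment> \<open>The factor 1/2 in the hypothesis on \<open>w\<close> is the price of the
    double-angle formula; the full-angle case satisfies it with room to spare.\<close>
  have main: "integrable angles (\<lambda>\<theta>. cmod (w \<theta> - b) powr - a) \<and>
      (LINT \<theta>|angles. cmod (w \<theta> - b) powr - a) \<le> (2 powr a * C) * r powr - a"
    if r: "r > 0" and \<psi>: "\<bar>\<psi>\<bar> \<le> 2 * pi" and w: "w \<in> borel_measurable borel"
     "\<And>\<theta>. cmod (w \<theta> - b) \<ge> r * \<bar>sin (\<theta> - \<psi>)\<bar> / 2" for w r b \<psi>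
  proof -
    define g where "g = (\<lambda>\<theta>. 2 powr a * r powr - a * \<bar>sin (\<theta> - \<psi>)\<bar> powr - a)"
    have g: "integrable angles g" unfolding g_def by (intro integrable_mult_right C \<psi>)
    have ae: "AE \<theta> in angles. cmod (w \<theta> - b) powr - a \<le> g \<theta>"
      using AE_sin_nonzero[OF \<psi>]
    proof eventually_elim
      case (elim \<theta>)
      have "cmod (w \<theta> - b) powr - a \<le> (r * \<bar>sin (\<theta> - \<psi>)\<bar> / 2) powr - a"
        using w(2)[of \<theta>] elim assms r by (intro powr_mono2') auto
      also have "\<dots> = g \<theta>" using r by (simp add: g_def powr_mult powr_divide powr_minus field_simps)
      finally show ?case .
    qed
    have int: "integrable angles (\<lambda>\<theta>. cmod (w \<theta> - b) powr - a)"
    proof (rule Bochner_Integration.integrable_bound[OF g])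
      show "AE \<theta> in angles. norm (cmod (w \<theta> - b) powr - a) \<le> norm (g \<theta>)"
        using ae by eventually_elim auto
      show "(\<lambda>\<theta>. cmod (w \<theta> - b) powr - a) \<in> borel_measurable angles"
        by (intro borel_measurable_angles) (use w(1) in measurable)
    qed
    have "(LINT \<theta>|angles. cmod (w \<theta> - b) powr - a) \<le> (LINT \<theta>|angles. g \<theta>)"
      by (intro integral_mono_AE int g ae)
    also have "\<dots> = 2 powr a * r powr - a * (LINT \<theta>|angles. \<bar>sin (\<theta> - \<psi>)\<bar> powr - a)"
      unfolding g_def by simp
    also have "\<dots> \<le> 2 powr a * r powr - a * C"
      by (intro mult_left_mono C \<psi>) auto
    finally show ?thesis using int by (simp add: mult_ac)
  qed
  have 1: "cmod (rcis r \<theta> - b) \<ge> r * \<bar>sin (\<theta> - Arg b)\<bar> / 2" if "r > 0" for r \<theta> b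
  proof -
    have "cmod (rcis r \<theta> - b) \<ge> r * \<bar>sin (\<theta> - Arg b)\<bar>" "r * \<bar>sin (\<theta> - Arg b)\<bar> \<ge> 0"
      using that norm_rcis_diff_ge[of r \<theta> b] by auto
    thus ?thesis by linarith
  qed
  have 2: "cmod (rcis r (\<theta> / 2) - b) \<ge> r * \<bar>sin (\<theta> - 2 * Arg b)\<bar> / 2" if "r > 0" for r \<theta> b
  proof -
    have "sin (\<theta> - 2 * Arg b) = 2 * sin (\<theta> / 2 - Arg b) * cos (\<theta> / 2 - Arg b)"
      using sin_double[of "\<theta> / 2 - Arg b"] by (simp add: algebra_simps)
    hence "\<bar>sin (\<theta> - 2 * Arg b)\<bar> / 2 \<le> \<bar>sin (\<theta> / 2 - Arg b)\<bar>"
      by (simp add: abs_mult mult_left_le)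
    hence "r * (\<bar>sin (\<theta> - 2 * Arg b)\<bar> / 2) \<le> r * \<bar>sin (\<theta> / 2 - Arg b)\<bar>"
      using that by (intro mult_left_mono) auto
    thus ?thesis using that norm_rcis_diff_ge[of r "\<theta> / 2" b]
      by (simp only: times_divide_eq_right) linarith
  qed
  have A: "\<bar>Arg b\<bar> \<le> 2 * pi" "\<bar>2 * Arg b\<bar> \<le> 2 * pi" for b
    using abs_Arg_le[of b] pi_gt_zero by auto
  show ?thesis
    by (rule that[of "2 powr a * C"])
      (use C(1) main[OF _ A(1) _ 1] main[OF _ A(2) _ 2] in auto)
qed

lemma abs_ln_le_powr:
  fixes t :: real
  assumes "t > 0"
  shows "\<bar>ln t\<bar> \<le> t + 2 * t powr - (1/2)"
proof -
  have "ln t \<le> t" using ln_le_minus_one[OF assms] by simp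
  moreover have "ln (t powr - (1/2)) \<le> t powr - (1/2)"
    using ln_le_minus_one[of "t powr - (1/2)"] assms by simp
  hence "- ln t \<le> 2 * t powr - (1/2)" using assms by (simp add: ln_powr)
  moreover have "t powr - (1/2) \<ge> 0" by simp
  ultimately show ?thesis using assms by linarith
qed

text \<open>Dividing by \<open>r\<close> makes the mean scale invariant, hence bounded uniformly in
  \<open>r\<close> and \<open>b\<close>. The range \<open>cmod b \<le> 2 * r\<close> is wide enough
  for points of a disc of radius \<open>5 * R\<close> seen from the circle of radius
  \<open>4 * R\<close>.\<close>

lemma circle_ln_bound:
  obtains C where "C \<ge> 0"
    "\<And>r b. r > 0 \<Longrightarrow> integrable angles (\<lambda>\<theta>. ln (cmod (rcis r \<theta> - b)))"
    "\<And>r b. r > 0 \<Longrightarrow> cmod b \<le> 2 * r \<Longrightarrow> (LINT \<theta>|angles. \<bar>ln (cmod (rcis r \<theta> - b) / r)\<bar>) \<le> C"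
proof -
  obtain C where C: "C \<ge> 0"
    "\<And>r b. r > 0 \<Longrightarrow> integrable angles (\<lambda>\<theta>. cmod (rcis r \<theta> - b) powr - (1/2))"
    "\<And>r b. r > 0 \<Longrightarrow> (LINT \<theta>|angles. cmod (rcis r \<theta> - b) powr - (1/2)) \<le> C * r powr - (1/2)"
    by (rule circle_powr_bound[of "1/2"]) auto
  define g where "g = (\<lambda>r b \<theta>. (1 + cmod b / r) + 2 * (r powr (1/2) * cmod (rcis r \<theta> - b) powr - (1/2)))"
  have g: "integrable angles (g r b)" if "r > 0" for r b
    unfolding g_def using that C(2) by (intro Bochner_Integration.integrable_add integrable_mult_right) auto
  have le: "AE \<theta> in angles. \<bar>ln (cmod (rcis r \<theta> - b) / r)\<bar> \<le> g r b \<theta>" if r: "r > 0" for r b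
    using AE_rcis_neq[OF r, of b]
  proof eventually_elim
    case (elim \<theta>)
    hence "\<bar>ln (cmod (rcis r \<theta> - b) / r)\<bar> \<le> cmod (rcis r \<theta> - b) / r + 2 * (cmod (rcis r \<theta> - b) / r) powr -(1/2)"
      using r by (intro abs_ln_le_powr) auto
    moreover have "cmod (rcis r \<theta> - b) / r \<le> (r + cmod b) / r"
      using r norm_triangle_ineq4[of "rcis r \<theta>" b] by (intro divide_right_mono) auto
    hence "cmod (rcis r \<theta> - b) / r \<le> 1 + cmod b / r" using r by (simp add: field_simps)
    moreover have "(cmod (rcis r \<theta> - b) / r) powr -(1/2) = r powr (1/2) * cmod (rcis r \<theta> - b) powr - (1/2)"
      using r by (simp add: powr_divide powr_minus field_simps)
    ultimately show ?case by (simp add: g_def)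
  qed
  have int: "integrable angles (\<lambda>\<theta>. ln (cmod (rcis r \<theta> - b) / r))" if "r > 0" for r b
  proof (rule Bochner_Integration.integrable_bound[OF g[OF that, of b]])
    show "AE \<theta> in angles. norm (ln (cmod (rcis r \<theta> - b) / r)) \<le> norm (g r b \<theta>)"
      using le[OF that, of b] by eventually_elim auto
  qed (intro borel_measurable_angles, measurable)
  show ?thesis
  proof
    show "integrable angles (\<lambda>\<theta>. ln (cmod (rcis r \<theta> - b)))" if r: "r > 0" for r b
    proof -
      have "integrable angles (\<lambda>\<theta>. ln (cmod (rcis r \<theta> - b) / r) + ln r)"
        using int[OF r] by (intro Bochner_Integration.integrable_add) auto
      also have "?this \<longleftrightarrow> ?thesis"
      proof (rule integrable_cong_AE)
        show "AE \<theta> in angles. ln (cmod (rcis r \<theta> - b) / r) + ln r = ln (cmod (rcis r \<theta> - b))"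
          using AE_rcis_neq[OF r, of b] by eventually_elim (use r in \<open>auto simp: ln_div\<close>)
        show "(\<lambda>\<theta>. ln (cmod (rcis r \<theta> - b) / r) + ln r) \<in> borel_measurable angles"
          by (rule borel_measurable_angles, measurable)
        show "(\<lambda>\<theta>. ln (cmod (rcis r \<theta> - b))) \<in> borel_measurable angles"
          by (rule borel_measurable_angles, measurable)
      qed
      finally show ?thesis .
    qed
    show "2 * pi * 3 + 2 * C \<ge> 0" using C by simp
    show "(LINT \<theta>|angles. \<bar>ln (cmod (rcis r \<theta> - b) / r)\<bar>) \<le> 2 * pi * 3 + 2 * C"
      if r: "r > 0" and b: "cmod b \<le> 2 * r" for r b
    proof -
      have "(LINT \<theta>|angles. \<bar>ln (cmod (rcis r \<theta> - b) / r)\<bar>) \<le> (LINT \<theta>|angles. g r b \<theta>)"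
        by (intro integral_mono_AE integrable_abs int g le r)
      also have "\<dots> = 2 * pi * (1 + cmod b / r) + 2 * (r powr (1/2) * (LINT \<theta>|angles. cmod (rcis r \<theta> - b) powr - (1/2)))"
        unfolding g_def using C(2)[OF r] by (subst Bochner_Integration.integral_add) auto
      also have "\<dots> \<le> 2 * pi * 3 + 2 * (r powr (1/2) * (C * r powr - (1/2)))"
        using r b by (intro add_mono mult_left_mono C(3)) (auto simp: field_simps)
      also have "r powr (1/2) * (C * r powr - (1/2)) = C"
        using r by (simp add: powr_minus field_simps)
      finally show ?thesis .
    qed
  qed
qed

section \<open>Mean values of harmonic functions and of ln |w - b| over circles\<close>

lemma contour_integral_circle_angles:
  assumes "(f has_contour_integral I) (circlepath 0 r)" "continuous_on (sphere 0 r) f" "r > 0"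
  shows "integrable angles (\<lambda>\<theta>. f (rcis r \<theta>) * (\<i> * rcis r \<theta>))"
    "I = (LINT \<theta>|angles. f (rcis r \<theta>) * (\<i> * rcis r \<theta>))"
proof -
  have "continuous_on {0..2*pi} (\<lambda>\<theta>. f (rcis r \<theta>))"
    by (rule continuous_on_compose2[OF assms(2)])
       (use assms(3) in \<open>auto simp: rcis_def norm_mult intro!: continuous_intros\<close>)
  thus int: "integrable angles (\<lambda>\<theta>. f (rcis r \<theta>) * (\<i> * rcis r \<theta>))"
    by (intro integrable_angles_continuous continuous_intros) (auto simp: rcis_def intro!: continuous_intros)
  have "((\<lambda>t. f (0 + r * cis t) * r * \<i> * cis t) has_integral I) {0..2*pi}"
    using assms(1) unfolding circlepath_def by (subst (asm) has_contour_integral_part_circlepath_iff) auto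
  hence "((\<lambda>\<theta>. f (rcis r \<theta>) * (\<i> * rcis r \<theta>)) has_integral I) {0..2*pi}"
    by (simp add: rcis_def mult_ac)
  thus "I = (LINT \<theta>|angles. f (rcis r \<theta>) * (\<i> * rcis r \<theta>))"
    using integral_angles_eq[OF int] by (simp add: integral_unique)
qed

lemma mean_value_Re:
  assumes "G holomorphic_on ball 0 R" "0 < r" "r < R"
  shows "integrable angles (\<lambda>\<theta>. Re (G (rcis r \<theta>)))"
    "(LINT \<theta>|angles. Re (G (rcis r \<theta>))) = 2 * pi * Re (G 0)"
proof -
  have "G holomorphic_on cball 0 r" by (rule holomorphic_on_subset[OF assms(1)]) (use assms in auto)
  hence "((\<lambda>u. G u / (u - 0)) has_contour_integral (2 * of_real pi * \<i> * G 0)) (circlepath 0 r)"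
    using Cauchy_integral_circlepath_simple[of G 0 r 0] assms by simp
  moreover have "continuous_on (sphere 0 r) (\<lambda>u. G u / (u - 0))"
    using assms by (intro continuous_intros holomorphic_on_imp_continuous_on[OF holomorphic_on_subset[OF assms(1)]]) auto
  ultimately have *: "integrable angles (\<lambda>\<theta>. G (rcis r \<theta>) / (rcis r \<theta> - 0) * (\<i> * rcis r \<theta>))"
    "2 * of_real pi * \<i> * G 0 = (LINT \<theta>|angles. G (rcis r \<theta>) / (rcis r \<theta> - 0) * (\<i> * rcis r \<theta>))"
    using contour_integral_circle_angles assms by blast+
  have eq: "G (rcis r \<theta>) / (rcis r \<theta> - 0) * (\<i> * rcis r \<theta>) = \<i> * G (rcis r \<theta>)" for \<theta>
    using assms by (simp add: rcis_def)
  have int: "integrable angles (\<lambda>\<theta>. G (rcis r \<theta>))" 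
    using integrable_mult_right[OF *(1), of "-\<i>"] unfolding eq by (simp flip: mult.assoc)
  thus "integrable angles (\<lambda>\<theta>. Re (G (rcis r \<theta>)))" by (rule integrable_Re)
  have "(LINT \<theta>|angles. G (rcis r \<theta>)) = 2 * of_real pi * G 0" using *(2) unfolding eq
    by (simp add: mult.assoc)
  thus "(LINT \<theta>|angles. Re (G (rcis r \<theta>))) = 2 * pi * Re (G 0)" using int by (simp add: integral_Re)
qed

lemma mean_ln_one_minus:
  assumes "cmod c < 1"
  shows "(LINT \<theta>|angles. ln (cmod (1 - c * cis \<theta>))) = 0"
proof -
  \<comment> \<open>Chosen with \<open>1 < R\<close> and \<open>cmod c * R < 1\<close>: then
    \<open>1 - c * w\<close> stays in the right half-plane on a ball containing the closed unit
    disc, and the principal logarithm is holomorphic there.\<close>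
  define R where "R = 2 / (1 + cmod c)"
  have "1 + cmod c > 0" by (simp add: add_pos_nonneg)
  hence R: "R > 1" and cR: "cmod c * R < 1" using assms by (simp_all add: R_def field_simps)
  have lt: "cmod (c * w) < 1" if "w \<in> ball 0 R" for w
  proof -
    have "cmod (c * w) \<le> cmod c * R" using that by (auto simp: norm_mult intro!: mult_left_mono)
    thus ?thesis using cR by simp
  qed
  have pos: "Re (1 - c * w) > 0" if "w \<in> ball 0 R" for w
    using lt[OF that] abs_Re_le_cmod[of "c * w"] by simp
  have "(\<lambda>w. Ln (1 - c * w)) holomorphic_on ball 0 R"
    by (intro holomorphic_intros) (use pos in \<open>simp add: complex_nonpos_Reals_iff not_le del: minus_complex.sel\<close>)
  from mean_value_Re(2)[OF this, of 1] R
  have "(LINT \<theta>|angles. Re (Ln (1 - c * rcis 1 \<theta>))) = 0" by simp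
  moreover have "Re (Ln (1 - c * rcis 1 \<theta>)) = ln (cmod (1 - c * cis \<theta>))" for \<theta>
  proof -
    have "Re (1 - c * cis \<theta>) > 0" using R by (intro pos) auto
    hence "1 - c * cis \<theta> \<noteq> 0" by (metis less_irrefl zero_complex.sel(1))
    thus ?thesis by (simp add: rcis_def)
  qed
  ultimately show ?thesis by simp
qed

text \<open>Off the circle, factoring out the larger of \<open>r\<close> and \<open>cmod b\<close>
  leaves the modulus of \<open>1 - c * cis \<theta>\<close> with \<open>cmod c < 1\<close>. For
  \<open>b\<close> on the circle the integrand is singular, and the value follows by moving
  \<open>b\<close> radially inwards and dominated convergence.\<close>

lemma mean_ln_circle:
  assumes r: "r > 0"
  shows "(LINT \<theta>|angles. ln (cmod (rcis r \<theta> - b))) = 2 * pi * ln (max r (cmod b))"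
proof -
  have aux: "(LINT \<theta>|angles. ln (cmod (rcis r \<theta> - b))) = 2 * pi * ln m"
    if c: "cmod c < 1" and m: "m > 0" and *: "\<And>\<theta>. cmod (rcis r \<theta> - b) = m * cmod (1 - c * cis \<theta>)" for m c b
  proof -
    have nz: "1 - c * cis \<theta> \<noteq> 0" for \<theta>
    proof
      assume "1 - c * cis \<theta> = 0"
      hence "cmod (c * cis \<theta>) = 1" by simp
      with c show False by (simp add: norm_mult)
    qed
    have "(LINT \<theta>|angles. ln (cmod (rcis r \<theta> - b))) = (LINT \<theta>|angles. ln m + ln (cmod (1 - c * cis \<theta>)))"
      using m nz by (simp add: * ln_mult)
    also have "integrable angles (\<lambda>\<theta>. ln (cmod (1 - c * cis \<theta>)))"
      using nz by (intro integrable_angles_continuous continuous_intros) auto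
    hence "(LINT \<theta>|angles. ln m + ln (cmod (1 - c * cis \<theta>))) = 2 * pi * ln m"
      by (subst Bochner_Integration.integral_add) (auto simp: mean_ln_one_minus[OF c])
    finally show ?thesis .
  qed
  have small: "(LINT \<theta>|angles. ln (cmod (rcis r \<theta> - b))) = 2 * pi * ln r" if "cmod b < r" for b
  proof (rule aux[of "cnj b / r"])
    fix \<theta>
    \<comment> \<open>Conjugation turns \<open>cis (- \<theta>)\<close> into
      \<open>cis \<theta>\<close> without changing the modulus, which gives the form required by
      \<open>mean_ln_one_minus\<close>.\<close>
    have "rcis r \<theta> - b = r * cis \<theta> * cnj (1 - cnj b / r * cis \<theta>)"
      using r by (simp add: rcis_def field_simps cis_mult cis_cnj)
    hence "cmod (rcis r \<theta> - b) = cmod (r * cis \<theta>) * cmod (cnj (1 - cnj b / r * cis \<theta>))"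
      by (simp only: norm_mult)
    thus "cmod (rcis r \<theta> - b) = r * cmod (1 - cnj b / r * cis \<theta>)"
      using r by (simp only: complex_mod_cnj norm_mult) simp
  qed (use that r in \<open>auto simp: norm_divide\<close>)
  consider "cmod b < r" | "cmod b > r" | "cmod b = r" by linarith
  thus ?thesis
  proof cases
    case 1
    thus ?thesis using small by (simp add: max_def)
  next
    case 2
    hence b: "b \<noteq> 0" using r by auto
    have "(LINT \<theta>|angles. ln (cmod (rcis r \<theta> - b))) = 2 * pi * ln (cmod b)"
    proof (rule aux[of "r / b"])
      fix \<theta>
      have "rcis r \<theta> - b = - b * (1 - r / b * cis \<theta>)" using b by (simp add: rcis_def field_simps)
      thus "cmod (rcis r \<theta> - b) = cmod b * cmod (1 - r / b * cis \<theta>)"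
        by (simp only: norm_mult norm_minus_cancel)
    qed (use 2 r b in \<open>auto simp: norm_divide\<close>)
    thus ?thesis using 2 by (simp add: max_def)
  next
    case 3
    define t where "t = (\<lambda>n::nat. 1 - 1 / real (n + 2))"
    have t: "0 < t n" "t n < 1" for n by (auto simp: t_def field_simps)
    have tlim: "t \<longlonglongrightarrow> 1" unfolding t_def by real_asymp
    have sin_int: "integrable angles (\<lambda>\<theta>. \<bar>sin (\<theta> - \<psi>)\<bar> powr - (1/2))" if "\<bar>\<psi>\<bar> \<le> 2 * pi" for \<psi>
      using that by (rule_tac sin_powr_integral_bound[of "1/2"]) auto
    \<comment> \<open>One dominating function for all \<open>n\<close>: \<open>t n * b\<close> has
      the same argument as \<open>b\<close>, so the lower bound for the distance by the sine does
      not depend on \<open>n\<close>.\<close>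
    define w where "w = (\<lambda>\<theta>. 2 * r + 2 * (r powr -(1/2) * \<bar>sin (\<theta> - Arg b)\<bar> powr - (1/2)))"
    have A: "\<bar>Arg b\<bar> \<le> 2 * pi" using abs_Arg_le[of b] pi_gt_zero by linarith
    have "(\<lambda>n. LINT \<theta>|angles. ln (cmod (rcis r \<theta> - t n * b))) \<longlonglongrightarrow> (LINT \<theta>|angles. ln (cmod (rcis r \<theta> - b)))"
    proof (rule integral_dominated_convergence[where w = w])
      show "integrable angles w" unfolding w_def
        by (intro Bochner_Integration.integrable_add integrable_mult_right sin_int[OF A]) auto
      show "AE \<theta> in angles. (\<lambda>n. ln (cmod (rcis r \<theta> - t n * b))) \<longlonglongrightarrow> ln (cmod (rcis r \<theta> - b))"
        using AE_rcis_neq[OF r, of b]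
      proof eventually_elim
        case (elim \<theta>)
        have "(\<lambda>n. ln (cmod (rcis r \<theta> - t n * b))) \<longlonglongrightarrow> ln (cmod (rcis r \<theta> - of_real 1 * b))"
          using elim by (intro tendsto_intros tlim) auto
        thus ?case by simp
      qed
      show "AE \<theta> in angles. norm (ln (cmod (rcis r \<theta> - t n * b))) \<le> w \<theta>" for n
        using AE_sin_nonzero[OF A]
      proof eventually_elim
        case (elim \<theta>)
        define d where "d = cmod (rcis r \<theta> - t n * b)"
        have "Arg (t n * b) = Arg b" using t[of n] by (simp add: Arg_times_of_real)
        hence d: "r * \<bar>sin (\<theta> - Arg b)\<bar> \<le> d" unfolding d_def
          using norm_rcis_diff_ge[of r \<theta> "t n * b"] r by simp
        have d0: "0 < r * \<bar>sin (\<theta> - Arg b)\<bar>" using elim r by simp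
        have "d \<le> r + t n * r" unfolding d_def
          using norm_triangle_ineq4[of "rcis r \<theta>" "t n * b"] r 3 t[of n] by (simp add: norm_mult)
        also have "t n * r \<le> r" using t[of n] r by (simp add: mult_left_le_one_le)
        finally have d2: "d \<le> 2 * r" by simp
        have "\<bar>ln d\<bar> \<le> d + 2 * d powr - (1/2)" using d d0 by (intro abs_ln_le_powr) auto
        also have "\<dots> \<le> 2 * r + 2 * (r * \<bar>sin (\<theta> - Arg b)\<bar>) powr - (1/2)"
          using d d0 d2 by (intro add_mono mult_left_mono powr_mono2') auto
        also have "\<dots> = w \<theta>" using r by (simp add: w_def powr_mult)
        finally show ?case by (simp add: d_def)
      qed
    qed (rule_tac [!] borel_measurable_angles, measurable)
    moreover have "(LINT \<theta>|angles. ln (cmod (rcis r \<theta> - t n * b))) = 2 * pi * ln r" for n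
      using t[of n] r 3 by (intro small) (simp add: norm_mult)
    ultimately have "(\<lambda>n::nat. 2 * pi * ln r) \<longlonglongrightarrow> (LINT \<theta>|angles. ln (cmod (rcis r \<theta> - b)))" by simp
    thus ?thesis using 3 by (simp add: LIMSEQ_const_iff)
  qed
qed

section \<open>Exceptional null sets of angles and measurability\<close>

lemma AE_rcis_half_neq:
  assumes "r > 0"
  shows "AE \<theta> in angles. rcis r (\<theta> / 2) \<noteq> b"
proof -
  have "\<bar>2 * Arg b\<bar> \<le> 2 * pi" using abs_Arg_le[of b] by linarith
  from AE_sin_nonzero[OF this] show ?thesis
  proof eventually_elim
    case (elim \<theta>)
    have "sin (\<theta> - 2 * Arg b) = 2 * sin (\<theta> / 2 - Arg b) * cos (\<theta> / 2 - Arg b)"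
      using sin_double[of "\<theta> / 2 - Arg b"] by (simp add: algebra_simps)
    hence "sin (\<theta> / 2 - Arg b) \<noteq> 0" using elim by auto
    hence "0 < r * \<bar>sin (\<theta> / 2 - Arg b)\<bar>" using assms by simp
    also have "\<dots> \<le> cmod (rcis r (\<theta> / 2) - b)" using assms by (intro norm_rcis_diff_ge) simp
    finally show ?case by auto
  qed
qed

lemma AE_rcis_countable:
  assumes "r > 0" "countable X"
  shows "AE \<theta> in angles. rcis r \<theta> \<notin> X" "AE \<theta> in angles. rcis r (\<theta> / 2) \<notin> X"
proof -
  have "AE \<theta> in angles. \<forall>b\<in>X. rcis r \<theta> \<noteq> b"
    using AE_rcis_neq[OF assms(1)] assms(2) by (subst AE_ball_countable) auto
  thus "AE \<theta> in angles. rcis r \<theta> \<notin> X" by eventually_elim auto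
  have "AE \<theta> in angles. \<forall>b\<in>X. rcis r (\<theta> / 2) \<noteq> b"
    using AE_rcis_half_neq[OF assms(1)] assms(2) by (subst AE_ball_countable) auto
  thus "AE \<theta> in angles. rcis r (\<theta> / 2) \<notin> X" by eventually_elim auto
qed

lemma cosparse_imp_countable:
  fixes P :: "complex \<Rightarrow> bool"
  assumes "eventually P (cosparse UNIV)"
  shows "countable {z. \<not> P z}"
  using sparse_imp_countable[OF open_UNIV, of "{z. \<not> P z}"] assms
  by (simp add: eventually_cosparse)

text \<open>Sparse sets in the plane are countable, and each point is met only on a null set of
  angles. This is how identities between meromorphic functions, valid off a sparse set, enter the
  integrals.\<close>

lemma AE_rcis_cosparse:
  assumes "r > 0" "eventually P (cosparse UNIV)"
  shows "AE \<theta> in angles. P (rcis r \<theta>)"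
  using AE_rcis_countable(1)[OF assms(1) cosparse_imp_countable[OF assms(2)]] by simp

text \<open>The values at singular points are arbitrary, but these points are countably many and the
  function is continuous elsewhere.\<close>

lemma meromorphic_imp_borel_measurable:
  assumes "f meromorphic_on UNIV"
  shows "f \<in> borel_measurable borel"
proof (rule measurable_restrict_countable)
  define X where "X = {z. \<not> f analytic_on {z}}"
  show "countable X" unfolding X_def
    by (rule cosparse_imp_countable) (rule meromorphic_on_imp_analytic_cosparse[OF assms])
  have "continuous_on (- X) f"
    by (rule continuous_at_imp_continuous_on) (auto simp: X_def analytic_at_imp_isCont)
  thus "f \<in> restrict_space borel (- X) \<rightarrow>\<^sub>M borel"
    by (rule borel_measurable_continuous_on_restrict)
qed auto

section \<open>Jensen's formula and Nevanlinna functions\<close>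

text \<open>For total functions whose values on a sparse set carry no information, this is the
  proper reading of "meromorphic and not identically zero".\<close>

definition nonzero_meromorphic :: "(complex \<Rightarrow> complex) \<Rightarrow> bool" where
  "nonzero_meromorphic f \<longleftrightarrow> f meromorphic_on UNIV \<and> (\<forall>\<^sub>\<approx>z. f z \<noteq> 0)"

text \<open>The value of \<open>zorder\<close> at a point where the function vanishes identically is unspecified, so the
  next definition is only used for functions satisfying \<open>nonzero_meromorphic\<close>.\<close>

definition zeros_poles :: "(complex \<Rightarrow> complex) \<Rightarrow> real \<Rightarrow> complex set" where
  "zeros_poles f r = {a. cmod a \<le> r \<and> zorder f a \<noteq> 0}"

lemma nonzero_meromorphicD:
  assumes "nonzero_meromorphic f"
  shows "f meromorphic_on A" "eventually (\<lambda>z. f z \<noteq> 0) (at a)" "frequently (\<lambda>z. f z \<noteq> 0) (at a)"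
    "isolated_singularity_at f a" "not_essential f a" "\<forall>\<^sub>\<approx>z. f z \<noteq> 0"
proof -
  have m: "f meromorphic_on UNIV" and nz: "\<forall>\<^sub>\<approx>z. f z \<noteq> 0"
    using assms by (auto simp: nonzero_meromorphic_def)
  show "f meromorphic_on A" "\<forall>\<^sub>\<approx>z. f z \<noteq> 0" using m nz by (auto intro: meromorphic_on_subset)
  show "eventually (\<lambda>z. f z \<noteq> 0) (at a)" using nz by (simp add: eventually_cosparse_open_eq)
  thus "frequently (\<lambda>z. f z \<noteq> 0) (at a)" by (simp add: eventually_frequently)
  show "isolated_singularity_at f a" "not_essential f a"
    using m by (auto simp: meromorphic_on_altdef)
qed

lemma nonzero_meromorphic_inverse:
  assumes "nonzero_meromorphic f"
  shows "nonzero_meromorphic (\<lambda>z. 1 / f z)" "zorder (\<lambda>z. 1 / f z) a = - zorder f a"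
proof -
  have "(\<lambda>z. 1 / f z) meromorphic_on UNIV"
    by (intro meromorphic_intros nonzero_meromorphicD[OF assms])
  thus "nonzero_meromorphic (\<lambda>z. 1 / f z)"
    using assms by (auto simp: nonzero_meromorphic_def)
  show "zorder (\<lambda>z. 1 / f z) a = - zorder f a"
    using zorder_inverse[of f a] nonzero_meromorphicD[OF assms] by (simp add: inverse_eq_divide)
qed

lemma is_pole_iff_zorder:
  assumes "nonzero_meromorphic f"
  shows "is_pole f a \<longleftrightarrow> zorder f a < 0"
  using nonzero_meromorphicD[OF assms] isolated_pole_imp_neg_zorder zorder_neg_imp_is_pole by blast

lemma finite_zeros_poles:
  assumes "nonzero_meromorphic f"
  shows "finite (zeros_poles f r)"
proof -
  note D = nonzero_meromorphicD[OF assms]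
  have "\<forall>\<^sub>\<approx>z. \<not> is_pole f z" "\<forall>\<^sub>\<approx>z. \<not> isolated_zero f z"
    using D(1) by (rule meromorphic_on_imp_not_pole_cosparse meromorphic_on_imp_not_zero_cosparse)+
  hence "\<forall>\<^sub>\<approx>z. zorder f z = 0"
    by eventually_elim (use D in \<open>auto intro: not_pole_not_isolated_zero_imp_zorder_eq_0\<close>)
  hence "{z. zorder f z \<noteq> 0} sparse_in UNIV" by (simp add: eventually_cosparse)
  hence "{z. zorder f z \<noteq> 0} sparse_in cball 0 r" by (rule sparse_in_subset) auto
  from sparse_in_compact_finite[OF this] show ?thesis
    by (rule finite_subset[rotated]) (auto simp: zeros_poles_def)
qed

section \<open>Factorization over the zeros and poles in a disc\<close>

lemma zorder_diff_const: "zorder (\<lambda>w. w - a) z = (if z = a then 1 else 0)"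
proof (cases "z = a")
  case True
  thus ?thesis by (auto intro!: zorder_eqI[of UNIV _ "\<lambda>_. 1"] holomorphic_intros)
next
  case False
  thus ?thesis by (auto intro!: zorder_eqI[of UNIV _ "\<lambda>w. w - a"] holomorphic_intros)
qed

lemma eventually_prod_diff_nonzero:
  assumes "finite S"
  shows "\<forall>\<^sub>F w in at z. (\<Prod>a\<in>S. (w - a) powi k a) \<noteq> (0 :: complex)"
proof -
  have "\<forall>\<^sub>F w in at z. w \<notin> S"
    using assms islimpt_finite[of S z] by (simp add: islimpt_iff_eventually)
  thus ?thesis by eventually_elim (use assms in auto)
qed

text \<open>Dividing by a product with the same orders leaves order 0 at every point of the closed
  disc. Once its singularities are removed, the quotient is analytic and zero-free on the ball,
  which is contractible, so it has a holomorphic logarithm.\<close>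

lemma meromorphic_factorization:
  assumes "nonzero_meromorphic f"
  obtains G where "G holomorphic_on ball 0 R"
    "\<forall>\<^sub>\<approx>w. cmod w < R \<longrightarrow> f w = exp (G w) * (\<Prod>a\<in>zeros_poles f R. (w - a) powi zorder f a)"
proof -
  note D = nonzero_meromorphicD[OF assms]
  define S where "S = zeros_poles f R"
  have fin: "finite S" unfolding S_def by (rule finite_zeros_poles[OF assms])
  define p where "p = (\<lambda>w. \<Prod>a\<in>S. (w - a) powi zorder f a)"
  define h where "h = (\<lambda>w. f w / p w)"
  have pm: "p meromorphic_on A" for A unfolding p_def by (intro meromorphic_intros)
  have pnz: "\<forall>\<^sub>F w in at z. p w \<noteq> 0" for z
    unfolding p_def by (rule eventually_prod_diff_nonzero[OF fin])
  have zp: "zorder p z = (if z \<in> S then zorder f z else 0)" for z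
  proof -
    have "zorder p z = (\<Sum>a\<in>S. zorder (\<lambda>w. (w - a) powi zorder f a) z)"
      unfolding p_def using pnz by (intro zorder_prod) (auto intro!: meromorphic_intros simp: p_def)
    also have "\<dots> = (\<Sum>a\<in>S. zorder f a * (if z = a then 1 else 0))"
    proof (intro sum.cong refl)
      fix a
      have "\<forall>\<^sub>F w in at z. w \<noteq> a" by (rule eventually_neq_at_within)
      hence "\<exists>\<^sub>F w in at z. w - a \<noteq> 0" by (intro eventually_frequently) auto
      thus "zorder (\<lambda>w. (w - a) powi zorder f a) z = zorder f a * (if z = a then 1 else 0)"
        by (subst zorder_power_int) (auto intro!: meromorphic_intros simp: zorder_diff_const)
    qed
    also have "\<dots> = (if z \<in> S then zorder f z else 0)"
      using fin by (simp add: if_distrib cong: if_cong)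
    finally show ?thesis .
  qed
  have hm: "h meromorphic_on A" for A unfolding h_def by (intro meromorphic_intros pm D)
  have hnz: "\<forall>\<^sub>F w in at z. h w \<noteq> 0" for z
    using pnz[of z] D(2)[of z] by eventually_elim (auto simp: h_def)
  have h0: "zorder h z = 0" if "cmod z \<le> R" for z
  proof -
    have "zorder h z = zorder f z - zorder p z"
      unfolding h_def using pnz[of z] D by (intro zorder_divide pm eventually_frequently) auto
    thus ?thesis using that by (auto simp: zp S_def zeros_poles_def)
  qed
  define H where "H = remove_sings h"
  have H: "H analytic_on {z}" "H z \<noteq> 0" if "cmod z \<le> R" for z
  proof -
    have iso: "isolated_singularity_at h z" "not_essential h z"
      using hm[of UNIV] by (auto simp: meromorphic_on_altdef)
    have np: "\<not> is_pole h z" using isolated_pole_imp_neg_zorder[OF iso(1)] h0[OF that] by auto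
    have nzr: "\<not> isolated_zero h z" using zorder_isolated_zero_pos'[OF _ iso(1)] h0[OF that] by auto
    obtain c where c: "h \<midarrow>z\<rightarrow> c" using iso(2) np by (auto simp: not_essential_def)
    show "H analytic_on {z}" unfolding H_def by (rule remove_sings_analytic_at[OF iso(1) c])
    show "H z \<noteq> 0"
      unfolding H_def remove_sings_eq_0_iff[OF iso(2)] using np nzr hnz[of z] by (auto simp: isolated_zero_def)
  qed
  have "H analytic_on ball 0 R" by (subst analytic_on_analytic_at) (use H in auto)
  hence "H holomorphic_on ball 0 R" by (rule analytic_imp_holomorphic)
  then obtain G where G: "G holomorphic_on ball 0 R" "\<And>z. z \<in> ball 0 R \<Longrightarrow> H z = exp (G z)"
    using contractible_imp_holomorphic_log[of H "ball 0 R"] H by (auto simp: convex_imp_contractible)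
  show ?thesis
  proof (rule that[OF G(1)])
    have "\<forall>\<^sub>\<approx>w. H w = h w" unfolding H_def by (rule eventually_remove_sings_eq[OF hm])
    moreover have "\<forall>\<^sub>\<approx>w. w \<notin> S"
      by (rule eventually_not_in_cosparse) (rule finite_imp_sparse[OF fin])
    ultimately show "\<forall>\<^sub>\<approx>w. cmod w < R \<longrightarrow> f w = exp (G w) * (\<Prod>a\<in>zeros_poles f R. (w - a) powi zorder f a)"
    proof eventually_elim
      case (elim w)
      have "p w \<noteq> 0" using elim(2) fin by (auto simp: p_def)
      thus ?case using elim(1) G(2)[of w] by (auto simp: h_def p_def S_def field_simps)
    qed
  qed
qed

text \<open>The circle estimates see only ln |f|: a harmonic part, open to mean values and
  derivative bounds, plus finitely many logarithmic potentials with known circle means.\<close>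

lemma ln_meromorphic_factorization:
  assumes "nonzero_meromorphic f"
  obtains G where "G holomorphic_on ball 0 R"
    "\<forall>\<^sub>\<approx>w. cmod w < R \<longrightarrow> f w \<noteq> 0 \<and> w \<notin> zeros_poles f R \<and>
       ln (cmod (f w)) = Re (G w) + (\<Sum>a\<in>zeros_poles f R. zorder f a * ln (cmod (w - a)))"
proof -
  have fin: "finite (zeros_poles f R)" by (rule finite_zeros_poles[OF assms])
  obtain G where G: "G holomorphic_on ball 0 R"
    "\<forall>\<^sub>\<approx>w. cmod w < R \<longrightarrow> f w = exp (G w) * (\<Prod>a\<in>zeros_poles f R. (w - a) powi zorder f a)"
    using meromorphic_factorization[OF assms] by blast
  have "\<forall>\<^sub>\<approx>w. w \<notin> zeros_poles f R"
    by (rule eventually_not_in_cosparse) (rule finite_imp_sparse[OF fin])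
  with G(2) have "\<forall>\<^sub>\<approx>w. cmod w < R \<longrightarrow> f w \<noteq> 0 \<and> w \<notin> zeros_poles f R \<and>
       ln (cmod (f w)) = Re (G w) + (\<Sum>a\<in>zeros_poles f R. zorder f a * ln (cmod (w - a)))"
  proof eventually_elim
    case (elim w)
    show ?case
    proof
      assume w: "cmod w < R"
      have nz: "w - a \<noteq> 0" if "a \<in> zeros_poles f R" for a using that elim(2) by auto
      have "ln (cmod (\<Prod>a\<in>zeros_poles f R. (w - a) powi zorder f a)) = (\<Sum>a\<in>zeros_poles f R. ln (cmod ((w - a) powi zorder f a)))"
        using nz by (subst prod_norm [symmetric], subst ln_prod) (auto simp: fin)
      also have "\<dots> = (\<Sum>a\<in>zeros_poles f R. zorder f a * ln (cmod (w - a)))"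
        using nz by (intro sum.cong refl) (simp add: norm_power_int flip: powr_real_of_int')
      finally have *: "ln (cmod (\<Prod>a\<in>zeros_poles f R. (w - a) powi zorder f a)) = (\<Sum>a\<in>zeros_poles f R. zorder f a * ln (cmod (w - a)))" .
      have pnz: "(\<Prod>a\<in>zeros_poles f R. (w - a) powi zorder f a) \<noteq> 0" using nz fin by auto
      have aux: "ln (cmod (exp (G w) * q)) = Re (G w) + ln (cmod q)" if "q \<noteq> 0" for q
        using that by (simp add: norm_mult ln_mult)
      show "f w \<noteq> 0 \<and> w \<notin> zeros_poles f R \<and> ln (cmod (f w)) = Re (G w) + (\<Sum>a\<in>zeros_poles f R. zorder f a * ln (cmod (w - a)))"
        using elim w pnz aux[OF pnz] * by simp
    qed
  qed
  with G(1) show ?thesis using that by blast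
qed

lemma circle_ln_meromorphic:
  assumes "nonzero_meromorphic f" "r > 0"
  shows "integrable angles (\<lambda>\<theta>. ln (cmod (f (rcis r \<theta>))))"
proof -
  obtain G where G: "G holomorphic_on ball 0 (r + 1)"
    "\<forall>\<^sub>\<approx>w. cmod w < r + 1 \<longrightarrow> f w \<noteq> 0 \<and> w \<notin> zeros_poles f (r + 1) \<and>
       ln (cmod (f w)) = Re (G w) + (\<Sum>a\<in>zeros_poles f (r + 1). zorder f a * ln (cmod (w - a)))"
    using ln_meromorphic_factorization[OF assms(1)] by blast
  have li: "integrable angles (\<lambda>\<theta>. ln (cmod (rcis r \<theta> - b)))" for b
    by (rule circle_ln_bound) (use assms in auto)
  have "integrable angles (\<lambda>\<theta>. Re (G (rcis r \<theta>)) + (\<Sum>a\<in>zeros_poles f (r + 1). zorder f a * ln (cmod (rcis r \<theta> - a))))"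
    by (intro Bochner_Integration.integrable_add Bochner_Integration.integrable_sum integrable_mult_right li mean_value_Re(1)[OF G(1)])
       (use assms in auto)
  moreover have "AE \<theta> in angles. Re (G (rcis r \<theta>)) + (\<Sum>a\<in>zeros_poles f (r + 1). zorder f a * ln (cmod (rcis r \<theta> - a))) = ln (cmod (f (rcis r \<theta>)))"
    using AE_rcis_cosparse[OF assms(2) G(2)] by eventually_elim (use assms in auto)
  moreover have "(\<lambda>\<theta>. ln (cmod (f (rcis r \<theta>)))) \<in> borel_measurable angles"
    using measurable_compose[OF rcis_measurable meromorphic_imp_borel_measurable[OF nonzero_meromorphicD(1)[OF assms(1)]]]
    by (intro borel_measurable_angles) measurable
  ultimately show ?thesis using integrable_cong_AE_imp by blast
qed

text \<open>The harmonic part has mean \<open>Re (G 0)\<close>, which is the constant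
  \<open>c\<close>, and the potentials are averaged by \<open>mean_ln_circle\<close>. Both
  \<open>G\<close> and \<open>c\<close> depend on \<open>R\<close>.\<close>

lemma jensen_fixed_disc:
  assumes "nonzero_meromorphic f" 
  obtains c where "\<And>r. 0 < r \<Longrightarrow> r < R \<Longrightarrow> (LINT \<theta>|angles. ln (cmod (f (rcis r \<theta>)))) =
     2 * pi * (c + (\<Sum>a\<in>zeros_poles f R. zorder f a * ln (max r (cmod a))))"
proof -
  obtain G where G: "G holomorphic_on ball 0 R"
    "\<forall>\<^sub>\<approx>w. cmod w < R \<longrightarrow> f w \<noteq> 0 \<and> w \<notin> zeros_poles f R \<and>
       ln (cmod (f w)) = Re (G w) + (\<Sum>a\<in>zeros_poles f R. zorder f a * ln (cmod (w - a)))"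
    using ln_meromorphic_factorization[OF assms(1)] by blast
  show ?thesis
  proof (rule that[of "Re (G 0)"])
    fix r assume r: "0 < r" "r < R"
    have li: "integrable angles (\<lambda>\<theta>. ln (cmod (rcis r \<theta> - b)))" for b
      by (rule circle_ln_bound) (use r in auto)
    have "(LINT \<theta>|angles. ln (cmod (f (rcis r \<theta>)))) = (LINT \<theta>|angles. Re (G (rcis r \<theta>)) + (\<Sum>a\<in>zeros_poles f R. zorder f a * ln (cmod (rcis r \<theta> - a))))"
    proof (rule integral_cong_AE)
      show "AE \<theta> in angles. ln (cmod (f (rcis r \<theta>))) = Re (G (rcis r \<theta>)) + (\<Sum>a\<in>zeros_poles f R. zorder f a * ln (cmod (rcis r \<theta> - a)))"
        using AE_rcis_cosparse[OF r(1) G(2)] by eventually_elim (use r in auto)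
      show "(\<lambda>\<theta>. ln (cmod (f (rcis r \<theta>)))) \<in> borel_measurable angles"
        using circle_ln_meromorphic[OF assms r(1)] by (rule borel_measurable_integrable)
      show "(\<lambda>\<theta>. Re (G (rcis r \<theta>)) + (\<Sum>a\<in>zeros_poles f R. zorder f a * ln (cmod (rcis r \<theta> - a)))) \<in> borel_measurable angles"
        by (rule borel_measurable_integrable)
           (intro Bochner_Integration.integrable_add Bochner_Integration.integrable_sum integrable_mult_right li mean_value_Re(1)[OF G(1)] r)
    qed
    also have "\<dots> = 2 * pi * Re (G 0) + (\<Sum>a\<in>zeros_poles f R. zorder f a * (2 * pi * ln (max r (cmod a))))"
      using mean_value_Re[OF G(1) r] li
      by (subst Bochner_Integration.integral_add) (auto simp: Bochner_Integration.integral_sum mean_ln_circle[OF r(1)])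
    finally show "(LINT \<theta>|angles. ln (cmod (f (rcis r \<theta>)))) =
      2 * pi * (Re (G 0) + (\<Sum>a\<in>zeros_poles f R. zorder f a * ln (max r (cmod a))))"
      by (simp add: sum_distrib_left algebra_simps)
  qed
qed

section \<open>Counting functions and Jensen's formula\<close>

definition log_weight :: "real \<Rightarrow> complex \<Rightarrow> real" where
  "log_weight r a = (if a = 0 then ln r else ln (r / cmod a))"

lemma log_weight_nonneg: "1 \<le> r \<Longrightarrow> cmod a \<le> r \<Longrightarrow> 0 \<le> log_weight r a"
  by (auto simp: log_weight_def)

lemma zeros_poles_inverse:
  "nonzero_meromorphic f \<Longrightarrow> zeros_poles (\<lambda>z. 1 / f z) r = zeros_poles f r"
  by (auto simp: zeros_poles_def nonzero_meromorphic_inverse)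

lemma zeros_poles_mono: "r \<le> s \<Longrightarrow> zeros_poles f r \<subseteq> zeros_poles f s"
  by (auto simp: zeros_poles_def)

text \<open>With \<open>max 0 (- zorder f a)\<close> as summand the index set may contain zeros as
  well, so \<open>f\<close> and \<open>1 / f\<close> are summed over the same set.\<close>

lemma pole_count_eq:
  assumes "nonzero_meromorphic f"
  shows "pole_count r f = (\<Sum>a\<in>zeros_poles f r. real_of_int (max 0 (- zorder f a)))"
  unfolding pole_count_def
  by (rule sum.mono_neutral_cong_left[OF finite_zeros_poles[OF assms]])
     (auto simp: is_pole_iff_zorder[OF assms] zeros_poles_def)

lemma pole_count_eq_restrict:
  assumes "nonzero_meromorphic f" "t \<le> r"
  shows "pole_count t f = (\<Sum>a\<in>zeros_poles f r. real_of_int (max 0 (- zorder f a)) * (if cmod a \<le> t then 1 else 0))"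
  unfolding pole_count_eq[OF assms(1)]
  by (rule sum.mono_neutral_cong_left[OF finite_zeros_poles[OF assms(1)]])
     (use assms(2) in \<open>auto simp: zeros_poles_def\<close>)

lemma has_integral_log_weight:
  fixes d r :: real
  assumes "0 < d" "d \<le> r"
  shows "((\<lambda>t. (if d \<le> t then 1 else 0) / t) has_integral ln (r / d)) {0..r}"
proof -
  have "((\<lambda>t. 1 / t) has_integral (ln r - ln d)) {d..r}"
    using assms by (intro fundamental_theorem_of_calculus)
      (auto intro!: derivative_eq_intros simp flip: has_real_derivative_iff_has_vector_derivative)
  hence "((\<lambda>t. if t \<in> {d..r} then 1 / t else 0) has_integral (ln r - ln d)) {0..r}"
    using assms by (subst has_integral_restrict) auto
  hence "((\<lambda>t. (if d \<le> t then 1 else 0) / t) has_integral (ln r - ln d)) {0..r}"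
    by (rule has_integral_eq[rotated]) auto
  thus ?thesis using assms by (simp add: ln_div)
qed

text \<open>\<open>log_weight r a\<close> is the share of a simple pole \<open>a\<close> in N(r):
  off the origin it enters the integrand as \<open>1 / t\<close> from \<open>t = cmod a\<close> on
  and yields \<open>ln (r / cmod a)\<close>. A pole at the origin cancels in the integrand and comes
  back through the term with \<open>ln r\<close>.\<close>

lemma integrated_pole_count_eq:
  assumes f: "nonzero_meromorphic f" and r: "r > 0"
  shows "integrated_pole_count r f = (\<Sum>a\<in>zeros_poles f r. real_of_int (max 0 (- zorder f a)) * log_weight r a)"
proof -
  let ?Z = "zeros_poles f r" and ?m = "\<lambda>a. real_of_int (max 0 (- zorder f a))"
  have fin: "finite ?Z" by (rule finite_zeros_poles[OF f])
  have "((\<lambda>t. \<Sum>a\<in>?Z. ?m a * (if a = 0 then 0 else (if cmod a \<le> t then 1 else 0) / t)) has_integral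
        (\<Sum>a\<in>?Z. ?m a * (if a = 0 then 0 else ln (r / cmod a)))) {0..r}"
  proof (intro has_integral_sum fin has_integral_mult_right)
    fix a assume a: "a \<in> ?Z"
    show "((\<lambda>t. if a = 0 then 0 else (if cmod a \<le> t then 1 else 0) / t) has_integral
           (if a = 0 then 0 else ln (r / cmod a))) {0..r}"
      using has_integral_log_weight[of "cmod a" r] a by (cases "a = 0") (auto simp: zeros_poles_def)
  qed
  hence "((\<lambda>t. (pole_count t f - pole_count 0 f) / t) has_integral
        (\<Sum>a\<in>?Z. ?m a * (if a = 0 then 0 else ln (r / cmod a)))) {0..r}"
  proof (rule has_integral_eq[rotated])
    fix t assume t: "t \<in> {0..r}"
    show "(\<Sum>a\<in>?Z. ?m a * (if a = 0 then 0 else (if cmod a \<le> t then 1 else 0) / t)) =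
           (pole_count t f - pole_count 0 f) / t"
      unfolding pole_count_eq_restrict[OF f, of t r, OF atLeastAtMost_iff[THEN iffD1, OF t, THEN conjunct2]]
        pole_count_eq_restrict[OF f, of 0 r, OF less_imp_le[OF r]] sum_subtractf[symmetric] sum_divide_distrib
      using t by (intro sum.cong) auto
  qed
  hence "integrated_pole_count r f = (\<Sum>a\<in>?Z. ?m a * (if a = 0 then 0 else ln (r / cmod a)))
      + (\<Sum>a\<in>?Z. ?m a * (if cmod a \<le> 0 then 1 else 0)) * ln r"
    unfolding integrated_pole_count_def using pole_count_eq_restrict[OF f, of 0 r] r
    by (simp add: integral_unique)
  also have "\<dots> = (\<Sum>a\<in>?Z. ?m a * log_weight r a)"
    unfolding sum_distrib_right sum.distrib[symmetric]
    by (intro sum.cong) (auto simp: log_weight_def)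
  finally show ?thesis .
qed

lemma integrated_pole_count_nonneg:
  "nonzero_meromorphic f \<Longrightarrow> 1 \<le> r \<Longrightarrow> 0 \<le> integrated_pole_count r f"
  by (simp add: integrated_pole_count_eq)
     (auto intro!: sum_nonneg mult_nonneg_nonneg log_weight_nonneg simp: zeros_poles_def)

text \<open>Each pole with \<open>cmod a \<le> r\<close> has weight at least \<open>ln 2\<close> at
  radius \<open>2 * r\<close>; at the origin the weight is \<open>ln (2 * r)\<close>, where
  \<open>r \<ge> 1\<close> is used.\<close>

lemma pole_count_le:
  assumes f: "nonzero_meromorphic f" and r: "r \<ge> 1"
  shows "pole_count r f * ln 2 \<le> integrated_pole_count (2 * r) f"
proof -
  have "pole_count r f * ln 2 = (\<Sum>a\<in>zeros_poles f r. real_of_int (max 0 (- zorder f a)) * ln 2)"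
    by (simp add: pole_count_eq[OF f] sum_distrib_right)
  also have "\<dots> \<le> (\<Sum>a\<in>zeros_poles f r. real_of_int (max 0 (- zorder f a)) * log_weight (2 * r) a)"
  proof (intro sum_mono mult_left_mono)
    fix a assume "a \<in> zeros_poles f r"
    hence "cmod a \<le> r" by (auto simp: zeros_poles_def)
    hence "a \<noteq> 0 \<Longrightarrow> 2 \<le> 2 * r / cmod a" by (simp add: field_simps)
    thus "ln 2 \<le> log_weight (2 * r) a" using r by (auto simp: log_weight_def)
  qed auto
  also have "\<dots> \<le> (\<Sum>a\<in>zeros_poles f (2 * r). real_of_int (max 0 (- zorder f a)) * log_weight (2 * r) a)"
    using r by (intro sum_mono2 finite_zeros_poles f zeros_poles_mono mult_nonneg_nonneg log_weight_nonneg)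
       (auto simp: zeros_poles_def)
  also have "\<dots> = integrated_pole_count (2 * r) f"
    using r by (simp add: integrated_pole_count_eq[OF f])
  finally show ?thesis .
qed

lemma sum_abs_zorder:
  assumes "nonzero_meromorphic f"
  shows "(\<Sum>a\<in>zeros_poles f r. real_of_int \<bar>zorder f a\<bar>) = pole_count r f + pole_count r (\<lambda>z. 1 / f z)"
  unfolding pole_count_eq[OF assms] pole_count_eq[OF nonzero_meromorphic_inverse(1)[OF assms]]
    zeros_poles_inverse[OF assms] nonzero_meromorphic_inverse(2)[OF assms] sum.distrib[symmetric]
  by (intro sum.cong) auto

lemma pole_count_nonneg: "nonzero_meromorphic f \<Longrightarrow> 0 \<le> pole_count r f"
  by (simp add: pole_count_eq sum_nonneg)

text \<open>The constant in \<open>jensen_fixed_disc\<close> changes with the disc. Comparing the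
  radii \<open>r\<close> and 1 inside the same disc of radius \<open>r + 1\<close> cancels it, and
  the remaining constant is fixed by the data at radius 1.\<close>

lemma jensen:
  assumes f: "nonzero_meromorphic f"
  obtains C where "\<And>r. r \<ge> 1 \<Longrightarrow> (LINT \<theta>|angles. ln (cmod (f (rcis r \<theta>)))) =
    2 * pi * (integrated_pole_count r (\<lambda>z. 1 / f z) - integrated_pole_count r f + C)"
proof -
  define D where "D = (\<lambda>r. \<Sum>a\<in>zeros_poles f r. zorder f a * log_weight r a)"
  have N: "integrated_pole_count r (\<lambda>z. 1 / f z) - integrated_pole_count r f = D r" if "r \<ge> 1" for r
  proof -
    have r: "r > 0" using that by simp
    show ?thesis
      unfolding integrated_pole_count_eq[OF f r] integrated_pole_count_eq[OF nonzero_meromorphic_inverse(1)[OF f] r]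
        zeros_poles_inverse[OF f] nonzero_meromorphic_inverse(2)[OF f] D_def sum_subtractf[symmetric]
      by (intro sum.cong) (auto simp: max_def)
  qed
  define J where "J = (\<lambda>r. LINT \<theta>|angles. ln (cmod (f (rcis r \<theta>))))"
  have "J r = 2 * pi * (D r + (J 1 / (2 * pi) - D 1))" if r: "r \<ge> 1" for r
  proof -
    obtain c where c: "\<And>s. 0 < s \<Longrightarrow> s < r + 1 \<Longrightarrow> J s =
       2 * pi * (c + (\<Sum>a\<in>zeros_poles f (r + 1). zorder f a * ln (max s (cmod a))))"
      unfolding J_def using jensen_fixed_disc[OF f, of "r + 1"] by blast
    have "J r - J 1 = 2 * pi * (\<Sum>a\<in>zeros_poles f (r + 1). zorder f a * (ln (max r (cmod a)) - ln (max 1 (cmod a))))"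
    proof -
      have "J r = 2 * pi * (c + (\<Sum>a\<in>zeros_poles f (r + 1). zorder f a * ln (max r (cmod a))))"
        "J 1 = 2 * pi * (c + (\<Sum>a\<in>zeros_poles f (r + 1). zorder f a * ln (max 1 (cmod a))))"
        using r by (intro c; simp)+
      thus ?thesis by (simp only: sum_subtractf right_diff_distrib distrib_left)
    qed
    \<comment> \<open>Points with \<open>cmod a > r\<close> drop out, because both maxima equal
      \<open>cmod a\<close>.\<close>
    also have "(\<Sum>a\<in>zeros_poles f (r + 1). zorder f a * (ln (max r (cmod a)) - ln (max 1 (cmod a))))
        = (\<Sum>a\<in>zeros_poles f r. zorder f a * (ln r - ln (max 1 (cmod a))))"
      by (rule sum.mono_neutral_cong_right[OF finite_zeros_poles[OF f]])
        (use r in \<open>auto simp: zeros_poles_def max_def\<close>)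
    \<comment> \<open>A point of the closed unit disc contributes \<open>ln r\<close>, the
      difference of its weights at radii \<open>r\<close> and 1; the other points have no
      counterpart at radius 1.\<close>
    also have "\<dots> = (\<Sum>a\<in>zeros_poles f r. zorder f a * log_weight r a - zorder f a * (if cmod a \<le> 1 then log_weight 1 a else 0))"
      using r by (intro sum.cong) (auto simp: log_weight_def max_def ln_div algebra_simps)
    also have "\<dots> = D r - (\<Sum>a\<in>zeros_poles f r. zorder f a * (if cmod a \<le> 1 then log_weight 1 a else 0))"
      by (simp add: sum_subtractf D_def)
    also have "(\<Sum>a\<in>zeros_poles f r. zorder f a * (if cmod a \<le> 1 then log_weight 1 a else 0)) = D 1"
      unfolding D_def
      by (rule sum.mono_neutral_cong_right[OF finite_zeros_poles[OF f]])
        (use r in \<open>auto simp: zeros_poles_def\<close>)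
    finally have "J r = J 1 + 2 * pi * (D r - D 1)" by linarith
    moreover have "2 * pi * (D r + (J 1 / (2 * pi) - D 1)) = J 1 + 2 * pi * (D r - D 1)"
      by (simp add: field_simps)
    ultimately show ?thesis by (rule trans[OF _ sym])
  qed
  note JD = this
  show ?thesis
  proof (rule that)
    fix r :: real assume r: "r \<ge> 1"
    show "(LINT \<theta>|angles. ln (cmod (f (rcis r \<theta>)))) =
      2 * pi * (integrated_pole_count r (\<lambda>z. 1 / f z) - integrated_pole_count r f + (J 1 / (2 * pi) - D 1))"
      using JD[OF r] unfolding N[OF r] by (simp only: J_def)
  qed
qed

section \<open>The positive logarithm, proximity and the first fundamental theorem\<close>

lemma ln_plus_nonneg [simp]: "0 \<le> ln_plus x"
  by (simp add: ln_plus_def)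

lemma ln_plus_le_abs_ln: "0 \<le> x \<Longrightarrow> ln_plus x \<le> \<bar>ln x\<bar>"
  by (simp add: ln_plus_def)

lemma ln_plus_measurable [measurable]: "ln_plus \<in> borel_measurable borel"
  unfolding ln_plus_def[abs_def] by measurable

text \<open>This includes \<open>x = 0\<close>, where \<open>1 / 0\<close> and \<open>ln 0\<close>
  are both 0, so it can be integrated without removing the zeros and poles.\<close>

lemma ln_plus_inverse: "0 \<le> x \<Longrightarrow> ln_plus x - ln_plus (1 / x) = ln x"
  by (cases "x = 0") (auto simp: ln_plus_def ln_div divide_le_eq)

lemma ln_plus_mono: "x \<le> y \<Longrightarrow> ln_plus x \<le> ln_plus y"
  by (auto simp: ln_plus_def)

lemma ln_plus_mult: "0 \<le> x \<Longrightarrow> 0 \<le> y \<Longrightarrow> ln_plus (x * y) \<le> ln_plus x + ln_plus y"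
proof -
  assume xy: "0 \<le> x" "0 \<le> y"
  show ?thesis
  proof (cases "x * y \<le> 1")
    case False
    hence "x > 0" "y > 0" using xy by (auto simp: less_le)
    hence "ln_plus (x * y) = ln x + ln y" using False by (simp add: ln_plus_def ln_mult)
    also have "\<dots> \<le> ln_plus x + ln_plus y" using \<open>x > 0\<close> \<open>y > 0\<close> by (intro add_mono) (auto simp: ln_plus_def)
    finally show ?thesis .
  qed (simp add: ln_plus_def[of "x * y"])
qed

lemma ln_plus_add: "0 \<le> x \<Longrightarrow> 0 \<le> y \<Longrightarrow> ln_plus (x + y) \<le> ln_plus x + ln_plus y + ln 2"
proof -
  assume xy: "0 \<le> x" "0 \<le> y"
  have "ln_plus (x + y) \<le> ln_plus (2 * max x y)" by (intro ln_plus_mono) auto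
  also have "\<dots> \<le> ln_plus 2 + ln_plus (max x y)" using xy by (intro ln_plus_mult) auto
  also have "ln_plus (max x y) \<le> ln_plus x + ln_plus y" by (auto simp: max_def)
  also have "ln_plus 2 = ln 2" by (simp add: ln_plus_def)
  finally show ?thesis by simp
qed

lemma circle_ln_plus:
  assumes "nonzero_meromorphic f" "r > 0"
  shows "integrable angles (\<lambda>\<theta>. ln_plus (cmod (f (rcis r \<theta>))))"
    "2 * pi * proximity r f = (LINT \<theta>|angles. ln_plus (cmod (f (rcis r \<theta>))))"
proof -
  show int: "integrable angles (\<lambda>\<theta>. ln_plus (cmod (f (rcis r \<theta>))))"
  proof (rule Bochner_Integration.integrable_bound[OF circle_ln_meromorphic[OF assms]])
    show "(\<lambda>\<theta>. ln_plus (cmod (f (rcis r \<theta>)))) \<in> borel_measurable angles"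
      using measurable_compose[OF rcis_measurable meromorphic_imp_borel_measurable[OF nonzero_meromorphicD(1)[OF assms(1)]]]
      by (intro borel_measurable_angles) measurable
    show "AE \<theta> in angles. norm (ln_plus (cmod (f (rcis r \<theta>)))) \<le> norm (ln (cmod (f (rcis r \<theta>))))"
      by (simp add: ln_plus_le_abs_ln)
  qed
  show "2 * pi * proximity r f = (LINT \<theta>|angles. ln_plus (cmod (f (rcis r \<theta>))))"
    using integral_angles_eq[OF int] by (simp add: proximity_def rcis_def cis_conv_exp mult_ac)
qed

lemma proximity_nonneg:
  assumes "nonzero_meromorphic f" "r > 0"
  shows "0 \<le> proximity r f"
proof -
  have "0 \<le> 2 * pi * proximity r f"
    unfolding circle_ln_plus(2)[OF assms] by (rule Bochner_Integration.integral_nonneg) simp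
  moreover have "0 < 2 * pi" by simp
  ultimately show ?thesis by (metis zero_le_mult_iff not_less)
qed

lemma proximity_inverse:
  assumes "nonzero_meromorphic f" "r > 0"
  shows "2 * pi * (proximity r f - proximity r (\<lambda>z. 1 / f z)) = (LINT \<theta>|angles. ln (cmod (f (rcis r \<theta>))))"
proof -
  note A = circle_ln_plus[OF assms] circle_ln_plus[OF nonzero_meromorphic_inverse(1)[OF assms(1)] assms(2)]
  have "2 * pi * (proximity r f - proximity r (\<lambda>z. 1 / f z)) =
     (LINT \<theta>|angles. ln_plus (cmod (f (rcis r \<theta>))) - ln_plus (cmod (1 / f (rcis r \<theta>))))"
    using A by (simp add: right_diff_distrib)
  also have "\<dots> = (LINT \<theta>|angles. ln (cmod (f (rcis r \<theta>))))"
    by (intro Bochner_Integration.integral_cong refl) (simp add: norm_divide ln_plus_inverse)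
  finally show ?thesis .
qed

text \<open>First fundamental theorem for the value 0: \<open>proximity_inverse\<close> rewrites the
  mean of ln |f| in Jensen's formula by the two proximity functions.\<close>

lemma nevanlinna_char_inverse:
  assumes "nonzero_meromorphic f"
  obtains C where "\<And>r. r \<ge> 1 \<Longrightarrow> nevanlinna_char r (\<lambda>z. 1 / f z) = nevanlinna_char r f + C"
proof -
  obtain C where C: "\<And>r. r \<ge> 1 \<Longrightarrow> (LINT \<theta>|angles. ln (cmod (f (rcis r \<theta>)))) =
    2 * pi * (integrated_pole_count r (\<lambda>z. 1 / f z) - integrated_pole_count r f + C)"
    using jensen[OF assms] by blast
  have "nevanlinna_char r (\<lambda>z. 1 / f z) = nevanlinna_char r f + (- C)" if "r \<ge> 1" for r
    using C[OF that] proximity_inverse[OF assms, of r] that by (simp add: nevanlinna_char_def)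
  thus ?thesis using that by blast
qed

lemma pole_count_diff_const:
  assumes "f meromorphic_on UNIV"
  shows "pole_count r (\<lambda>z. f z - c) = pole_count r f"
\<comment> \<open>For \<open>c \<noteq> 0\<close> the constant has order 0, above the negative order
  at a pole, so subtracting it keeps the order. The zero function has no specified order and is
  split off.\<close>
proof (cases "c = 0")
  case False
  have "zorder (\<lambda>z. f z - c) z = zorder f z" if "is_pole f z" for z
  proof (rule zorder_diff1)
    have "isolated_singularity_at f z" using assms by (auto simp: meromorphic_on_altdef)
    thus "zorder f z < zorder (\<lambda>_. c) z" using isolated_pole_imp_neg_zorder that False by simp
    show "f meromorphic_on {z}" using assms by (rule meromorphic_on_subset) auto
    show "\<exists>\<^sub>F w in at z. f w \<noteq> 0" 
      by (intro eventually_frequently non_zero_neighbour_pole that) auto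
  qed (use False in auto)
  thus ?thesis unfolding pole_count_def is_pole_minus_const_iff by (intro sum.cong) auto
qed simp

lemma nevanlinna_char_diff_const:
  assumes "nonzero_meromorphic f" "nonzero_meromorphic (\<lambda>z. f z - c)" "r > 0"
  shows "nevanlinna_char r (\<lambda>z. f z - c) \<le> nevanlinna_char r f + (ln_plus (cmod c) + ln 2)"
proof -
  have "2 * pi * proximity r (\<lambda>z. f z - c) = (LINT \<theta>|angles. ln_plus (cmod (f (rcis r \<theta>) - c)))"
    by (rule circle_ln_plus[OF assms(2,3)])
  also have "\<dots> \<le> (LINT \<theta>|angles. ln_plus (cmod (f (rcis r \<theta>))) + (ln_plus (cmod c) + ln 2))"
  proof (intro integral_mono circle_ln_plus(1)[OF assms(2,3)] Bochner_Integration.integrable_add circle_ln_plus(1)[OF assms(1,3)] integrable_angles_const)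
    fix \<theta>
    have "ln_plus (cmod (f (rcis r \<theta>) - c)) \<le> ln_plus (cmod (f (rcis r \<theta>)) + cmod c)"
      by (intro ln_plus_mono norm_triangle_ineq4)
    also have "\<dots> \<le> ln_plus (cmod (f (rcis r \<theta>))) + (ln_plus (cmod c) + ln 2)"
      using ln_plus_add[of "cmod (f (rcis r \<theta>))" "cmod c"] by simp
    finally show "ln_plus (cmod (f (rcis r \<theta>) - c)) \<le> ln_plus (cmod (f (rcis r \<theta>))) + (ln_plus (cmod c) + ln 2)" .
  qed
  also have "\<dots> = 2 * pi * (proximity r f + (ln_plus (cmod c) + ln 2))"
    using circle_ln_plus[OF assms(1,3)] by (subst Bochner_Integration.integral_add) (simp_all only: integrable_angles_const integral_angles_const distrib_left)
  finally have "proximity r (\<lambda>z. f z - c) \<le> proximity r f + (ln_plus (cmod c) + ln 2)" by simp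
  moreover have "integrated_pole_count r (\<lambda>z. f z - c) = integrated_pole_count r f"
    using pole_count_diff_const[OF nonzero_meromorphicD(1)[OF assms(1)]] by (simp add: integrated_pole_count_def)
  ultimately show ?thesis by (simp add: nevanlinna_char_def)
qed

section \<open>Consequences of finite order\<close>

lemma growth_order_bounds:
  assumes "growth_order f = ereal \<sigma>"
  shows "\<sigma> \<ge> 0" "\<delta> > 0 \<Longrightarrow> \<forall>\<^sub>F r in at_top. nevanlinna_char r f \<le> r powr (\<sigma> + \<delta>)"
proof -
  have "\<forall>\<^sub>F r in at_top. (0::ereal) \<le> ereal (ln_plus (nevanlinna_char r f) / ln r)"
    using eventually_ge_at_top[of "1::real"] by eventually_elim simp
  hence "0 \<le> growth_order f" unfolding growth_order_def by (intro le_Limsup) auto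
  thus \<sigma>: "\<sigma> \<ge> 0" using assms by simp
  assume \<delta>: "\<delta> > 0"
  have "growth_order f < ereal (\<sigma> + \<delta>)" using assms \<delta> by simp
  hence "\<forall>\<^sub>F r in at_top. ereal (ln_plus (nevanlinna_char r f) / ln r) < ereal (\<sigma> + \<delta>)"
    unfolding growth_order_def by (rule Limsup_lessD)
  with eventually_gt_at_top[of 1] show "\<forall>\<^sub>F r in at_top. nevanlinna_char r f \<le> r powr (\<sigma> + \<delta>)"
  proof eventually_elim
    case (elim r)
    hence *: "ln_plus (nevanlinna_char r f) \<le> (\<sigma> + \<delta>) * ln r" by (simp add: field_simps)
    have "nevanlinna_char r f \<le> exp (ln_plus (nevanlinna_char r f))" by (simp add: ln_plus_def)
    also have "\<dots> \<le> exp ((\<sigma> + \<delta>) * ln r)" using * by simp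
    also have "\<dots> = r powr (\<sigma> + \<delta>)" using elim by (simp add: powr_def)
    finally show ?case .
  qed
qed

text \<open>Collects what controls the factorization on a disc: the proximities bound the mean of
  the absolute value of ln |f|, and the pole counts of \<open>f\<close> and \<open>1 / f\<close>
  bound the number of factors.\<close>

definition value_distribution_size :: "real \<Rightarrow> (complex \<Rightarrow> complex) \<Rightarrow> real" where
  "value_distribution_size r f =
     proximity r f + proximity r (\<lambda>z. 1 / f z) + pole_count r f + pole_count r (\<lambda>z. 1 / f z)"

text \<open>Pole counts at radius \<open>r\<close> are bounded by the characteristic at
  \<open>2 * r\<close>; under a power bound, doubling the radius costs only the factor
  \<open>2 powr \<rho>\<close>.\<close>

lemma value_distribution_size_bound:
  assumes f: "nonzero_meromorphic f" and \<rho>: "\<rho> \<ge> 0" and K: "K \<ge> 0"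
    and T: "\<forall>\<^sub>F r in at_top. nevanlinna_char r f \<le> K * r powr \<rho>"
  obtains K' where "K' \<ge> 0" "\<forall>\<^sub>F r in at_top. value_distribution_size r f \<le> K' * r powr \<rho>"
proof -
  let ?g = "\<lambda>z. 1 / f z"
  have g: "nonzero_meromorphic ?g" by (rule nonzero_meromorphic_inverse(1)[OF f])
  obtain C where C: "\<And>r. r \<ge> 1 \<Longrightarrow> nevanlinna_char r ?g = nevanlinna_char r f + C"
    using nevanlinna_char_inverse[OF f] by blast
  \<comment> \<open>One constant for \<open>f\<close> and \<open>1 / f\<close> at both radii:
    \<open>2 powr \<rho>\<close> pays for the doubling, and \<open>\<bar>C\<bar>\<close>, the error
    in passing to \<open>1 / f\<close>, is absorbed because
    \<open>r powr \<rho> \<ge> 1\<close>.\<close>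
  define M where "M = K * 2 powr \<rho> + \<bar>C\<bar>"
  have M: "M \<ge> 0" unfolding M_def using K by simp
  have "filterlim (\<lambda>r::real. 2 * r) at_top at_top" by real_asymp
  from eventually_compose_filterlim[OF T this]
  have T2: "\<forall>\<^sub>F r in at_top. nevanlinna_char (2 * r) f \<le> K * (2 * r) powr \<rho>" .
  have "\<forall>\<^sub>F r in at_top. value_distribution_size r f \<le> (2 * M + 2 * (M / ln 2)) * r powr \<rho>"
    using T T2 eventually_ge_at_top[of 1]
  proof eventually_elim
    case (elim r)
    have r1: "r powr \<rho> \<ge> 1" using elim \<rho> by (simp add: ge_one_powr_ge_zero)
    have C1: "\<bar>C\<bar> \<le> \<bar>C\<bar> * r powr \<rho>" using mult_left_mono[OF r1, of "\<bar>C\<bar>"] by simp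
    have K1: "K * r powr \<rho> \<le> K * 2 powr \<rho> * r powr \<rho>"
    proof -
      have "1 \<le> (2::real) powr \<rho>" using \<rho> by (simp add: ge_one_powr_ge_zero)
      thus ?thesis using K mult_right_mono[of 1 "2 powr \<rho>" "K * r powr \<rho>"] by (simp add: mult_ac)
    qed
    have K2: "K * (2 * r) powr \<rho> = K * 2 powr \<rho> * r powr \<rho>" using elim by (simp add: powr_mult)
    have KM: "K * 2 powr \<rho> * r powr \<rho> + \<bar>C\<bar> * r powr \<rho> = M * r powr \<rho>" by (simp add: M_def algebra_simps)
    have b: "nevanlinna_char r f \<le> M * r powr \<rho>" "nevanlinna_char r ?g \<le> M * r powr \<rho>"
      "nevanlinna_char (2 * r) f \<le> M * r powr \<rho>" "nevanlinna_char (2 * r) ?g \<le> M * r powr \<rho>"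
      using elim C[of r] C[of "2 * r"] C1 K1 K2 KM by linarith+
    have pr: "proximity r h \<le> nevanlinna_char r h" if "nonzero_meromorphic h" for h
      using integrated_pole_count_nonneg[OF that, of r] elim by (simp add: nevanlinna_char_def)
    have pc: "pole_count r h \<le> nevanlinna_char (2 * r) h / ln 2" if "nonzero_meromorphic h" for h
    proof -
      have "pole_count r h * ln 2 \<le> nevanlinna_char (2 * r) h"
        using pole_count_le[OF that, of r] proximity_nonneg[OF that, of "2 * r"] elim
        by (simp add: nevanlinna_char_def)
      thus ?thesis by (simp add: field_simps)
    qed
    have bd: "nevanlinna_char (2 * r) f / ln 2 \<le> M * r powr \<rho> / ln 2" "nevanlinna_char (2 * r) ?g / ln 2 \<le> M * r powr \<rho> / ln 2"
      using b by (auto intro!: divide_right_mono)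
    have "value_distribution_size r f \<le> M * r powr \<rho> + M * r powr \<rho> + M * r powr \<rho> / ln 2 + M * r powr \<rho> / ln 2"
      unfolding value_distribution_size_def
      using pr[OF f] pr[OF g] pc[OF f] pc[OF g] b bd by linarith
    thus ?case by (simp add: algebra_simps)
  qed
  thus ?thesis using M by (intro that[of "2 * M + 2 * (M / ln 2)"]) auto
qed

section \<open>Logarithmic differences\<close>

text \<open>The conjugate of \<open>G\<close> times the Cauchy kernel squared integrates to zero over the circle, which
  is Cauchy's theorem after reflecting \<open>w\<close> in the circle; so only the real part of \<open>G\<close> is left in
  Cauchy's formula for the derivative.\<close>

lemma deriv_bound_Re:
  assumes G: "G holomorphic_on ball 0 R'" and R: "0 < R" "R < R'" and w: "cmod w < R"
  shows "cmod (deriv G w) \<le> R / (pi * (R - cmod w)\<^sup>2) * (LINT \<theta>|angles. \<bar>Re (G (rcis R \<theta>))\<bar>)"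
proof -
  have Gc: "G holomorphic_on cball 0 R" by (rule holomorphic_on_subset[OF G]) (use R in auto)
  have cont: "continuous_on (sphere 0 R) G" 
    by (rule holomorphic_on_imp_continuous_on, rule holomorphic_on_subset[OF Gc]) auto
  define I where "I = contour_integral (circlepath 0 R) (\<lambda>u. G u / (u - w)\<^sup>2)"
  have *: "(\<lambda>u. G u / (u - w)\<^sup>2) contour_integrable_on circlepath 0 R"
    "(G has_field_derivative (1 / (2 * of_real pi * \<i>) * I)) (at w)"
    unfolding I_def using w
    by (intro Cauchy_derivative_integral_circlepath holomorphic_on_imp_continuous_on Gc holomorphic_on_subset[OF Gc] ball_subset_cball; simp)+
  have d: "deriv G w = 1 / (2 * of_real pi * \<i>) * I" by (rule DERIV_imp_deriv[OF *(2)])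
  have "((\<lambda>u. G u / (u - w)\<^sup>2) has_contour_integral I) (circlepath 0 R)"
    unfolding I_def by (rule has_contour_integral_integral[OF *(1)])
  moreover have "continuous_on (sphere 0 R) (\<lambda>u. G u / (u - w)\<^sup>2)"
    using w by (intro continuous_intros cont) auto
  ultimately have I: "integrable angles (\<lambda>\<theta>. G (rcis R \<theta>) / (rcis R \<theta> - w)\<^sup>2 * (\<i> * rcis R \<theta>))"
    "I = (LINT \<theta>|angles. G (rcis R \<theta>) / (rcis R \<theta> - w)\<^sup>2 * (\<i> * rcis R \<theta>))"
    using contour_integral_circle_angles R by blast+
  have nz: "of_real (R\<^sup>2) - cnj w * u \<noteq> 0" if "cmod u \<le> R" for u
  proof
    assume "of_real (R\<^sup>2) - cnj w * u = 0"
    hence "cnj w * u = of_real (R\<^sup>2)" by simp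
    hence "cmod w * cmod u = R\<^sup>2" by (metis complex_mod_cnj norm_mult norm_of_real abs_power2)
    moreover have "cmod w * cmod u \<le> cmod w * R" using that by (intro mult_left_mono) auto
    moreover have "cmod w * R < R * R" using w R by (intro mult_strict_right_mono) auto
    ultimately show False by (simp add: power2_eq_square)
  qed
  \<comment> \<open>The denominator could vanish only at the reflected point
    \<open>R\<^sup>2 / cnj w\<close>, which lies outside the closed disc.\<close>
  let ?f = "\<lambda>u. G u * of_real (R\<^sup>2) / (of_real (R\<^sup>2) - cnj w * u)\<^sup>2"
  have "?f holomorphic_on cball 0 R"
    using nz by (intro holomorphic_intros Gc) auto
  hence "(?f has_contour_integral 0) (circlepath 0 R)"
    using R by (intro Cauchy_theorem_convex_simple[of _ "cball 0 R"]) auto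
  moreover have "continuous_on (sphere 0 R) ?f"
    using nz by (intro continuous_intros cont) auto
  ultimately have Z: "integrable angles (\<lambda>\<theta>. ?f (rcis R \<theta>) * (\<i> * rcis R \<theta>))"
    "0 = (LINT \<theta>|angles. ?f (rcis R \<theta>) * (\<i> * rcis R \<theta>))"
    using contour_integral_circle_angles R by blast+
  define k where "k = (\<lambda>\<theta>. rcis R \<theta> / (rcis R \<theta> - w)\<^sup>2)"
  have eq1: "G (rcis R \<theta>) / (rcis R \<theta> - w)\<^sup>2 * (\<i> * rcis R \<theta>) = \<i> * (G (rcis R \<theta>) * k \<theta>)" for \<theta>
    by (simp add: k_def)
  \<comment> \<open>On the circle \<open>R\<^sup>2 = u * cnj u\<close>, hence
    \<open>R\<^sup>2 - w * cnj u = cnj u * (u - w)\<close>: conjugating the vanishing integral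
    yields one of \<open>cnj G\<close> against the same kernel \<open>k\<close> that carries
    \<open>G\<close>.\<close>
  have eq2: "cnj (?f (rcis R \<theta>) * (\<i> * rcis R \<theta>)) = - \<i> * (cnj (G (rcis R \<theta>)) * k \<theta>)" for \<theta>
  proof -
    define u where "u = rcis R \<theta>"
    have u0: "cnj u \<noteq> 0" using R by (auto simp: u_def rcis_def)
    have uR: "cmod u = R" using R by (simp add: u_def)
    have uu: "of_real (R\<^sup>2) = u * cnj u" unfolding uR[symmetric] by (rule complex_norm_square)
    have e: "of_real (R\<^sup>2) - w * cnj u = cnj u * (u - w)" unfolding uu by (simp add: algebra_simps)
    have e': "of_real (R\<^sup>2) / (of_real (R\<^sup>2) - w * cnj u)\<^sup>2 * cnj u = u / (u - w)\<^sup>2"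
      unfolding e unfolding uu unfolding power_mult_distrib using u0 by (simp add: power2_eq_square)
    have "cnj (?f u * (\<i> * u)) = - \<i> * (cnj (G u) * (of_real (R\<^sup>2) / (of_real (R\<^sup>2) - w * cnj u)\<^sup>2 * cnj u))"
      by (simp add: mult_ac)
    thus ?thesis unfolding e' by (simp only: u_def k_def)
  qed
  have i1: "integrable angles (\<lambda>\<theta>. G (rcis R \<theta>) * k \<theta>)"
    using integrable_mult_right[OF I(1), of "-\<i>"] unfolding eq1 by (simp flip: mult.assoc)
  have "integrable angles (\<lambda>\<theta>. cnj (?f (rcis R \<theta>) * (\<i> * rcis R \<theta>)))"
    using Z(1) by (rule integrable_cnj)
  hence "integrable angles (\<lambda>\<theta>. \<i> * (- \<i> * (cnj (G (rcis R \<theta>)) * k \<theta>)))"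
    unfolding eq2 by (rule integrable_mult_right)
  hence i2: "integrable angles (\<lambda>\<theta>. cnj (G (rcis R \<theta>)) * k \<theta>)" by (simp flip: mult.assoc)
  have "(LINT \<theta>|angles. cnj (?f (rcis R \<theta>) * (\<i> * rcis R \<theta>))) = cnj 0"
    unfolding Z(2) using Z(1) by (intro integral_bounded_linear[OF bounded_linear_cnj])
  hence z2: "(LINT \<theta>|angles. cnj (G (rcis R \<theta>)) * k \<theta>) = 0"
    unfolding eq2 by simp
  have "I = \<i> * (LINT \<theta>|angles. G (rcis R \<theta>) * k \<theta>)"
    unfolding I(2) eq1 by simp
  also have "(LINT \<theta>|angles. G (rcis R \<theta>) * k \<theta>) = (LINT \<theta>|angles. G (rcis R \<theta>) * k \<theta> + cnj (G (rcis R \<theta>)) * k \<theta>)"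
    using i1 i2 z2 by simp
  also have "\<dots> = (LINT \<theta>|angles. 2 * of_real (Re (G (rcis R \<theta>))) * k \<theta>)"
    by (simp only: distrib_right[symmetric] complex_add_cnj) simp
  finally have I': "cmod I = cmod (LINT \<theta>|angles. 2 * of_real (Re (G (rcis R \<theta>))) * k \<theta>)"
    by (simp add: norm_mult)
  define c where "c = 2 * R / (R - cmod w)\<^sup>2"
  have "continuous_on {0..2*pi} (\<lambda>\<theta>. Re (G (rcis R \<theta>)))"
    by (intro continuous_intros continuous_on_compose2[OF cont])
       (use R in \<open>auto simp: rcis_def norm_mult intro!: continuous_intros\<close>)
  hence iR: "integrable angles (\<lambda>\<theta>. \<bar>Re (G (rcis R \<theta>))\<bar>)"
    by (intro integrable_angles_continuous continuous_on_rabs)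
  have "cmod I \<le> (LINT \<theta>|angles. c * \<bar>Re (G (rcis R \<theta>))\<bar>)"
    unfolding I'
  proof (rule order_trans[OF Bochner_Integration.integral_norm_bound], rule integral_mono)
    show "integrable angles (\<lambda>\<theta>. cmod (2 * of_real (Re (G (rcis R \<theta>))) * k \<theta>))"
      using Bochner_Integration.integrable_add[OF i1 i2, THEN integrable_norm]
      by (simp only: distrib_right[symmetric] complex_add_cnj) simp
    show "integrable angles (\<lambda>\<theta>. c * \<bar>Re (G (rcis R \<theta>))\<bar>)" by (intro integrable_mult_right iR)
    fix \<theta>
    have le: "R - cmod w \<le> cmod (rcis R \<theta> - w)"
      using norm_triangle_ineq2[of "rcis R \<theta>" w] R by simp
    have "cmod (k \<theta>) = R / (cmod (rcis R \<theta> - w))\<^sup>2" using R by (simp add: k_def norm_divide norm_power)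
    also have "\<dots> \<le> R / (R - cmod w)\<^sup>2" using le w R by (intro divide_left_mono power_mono mult_pos_pos zero_less_power) auto
    finally have "2 * \<bar>Re (G (rcis R \<theta>))\<bar> * cmod (k \<theta>) \<le> 2 * \<bar>Re (G (rcis R \<theta>))\<bar> * (R / (R - cmod w)\<^sup>2)"
      by (intro mult_left_mono) auto
    thus "cmod (2 * of_real (Re (G (rcis R \<theta>))) * k \<theta>) \<le> c * \<bar>Re (G (rcis R \<theta>))\<bar>"
      by (simp add: norm_mult c_def mult_ac)
  qed
  hence "cmod I \<le> c * (LINT \<theta>|angles. \<bar>Re (G (rcis R \<theta>))\<bar>)" by simp
  hence "1 / (2 * pi) * cmod I \<le> 1 / (2 * pi) * (c * (LINT \<theta>|angles. \<bar>Re (G (rcis R \<theta>))\<bar>))"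
    by (intro mult_left_mono) auto
  also have "1 / (2 * pi) * cmod I = cmod (deriv G w)" by (simp add: d norm_mult norm_divide)
  finally show ?thesis by (simp add: c_def)
qed

section \<open>Differences of logarithms under the shift\<close>

lemma ln_one_plus_le_powr:
  fixes t a :: real
  assumes "t \<ge> 0" "0 < a" "a < 1"
  shows "ln (1 + t) \<le> (1 + 1 / a) * t powr a"
proof (cases "t \<le> 1")
  case True
  have "ln (1 + t) \<le> t" using assms by (intro ln_add_one_self_le_self) auto
  also have "t \<le> t powr a" using powr_mono'[of a 1 t] True assms by simp
  also have "\<dots> \<le> (1 + 1 / a) * t powr a" using assms mult_right_mono[of 1 "1 + 1 / a" "t powr a"] by simp
  finally show ?thesis .
next
  case False
  have "ln (1 + t) \<le> ln (2 * t)" using False by simp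
  also have "\<dots> = ln 2 + ln t" using False by (simp add: ln_mult)
  also have "ln (2::real) \<le> 1" using ln_le_minus_one[of 2] by simp
  also have "1 \<le> t powr a" using False assms by (simp add: ge_one_powr_ge_zero)
  also have "ln t \<le> t powr a / a"
  proof -
    have "ln (t powr a) \<le> t powr a" using ln_le_minus_one[of "t powr a"] False by simp
    thus ?thesis using assms False by (simp add: field_simps)
  qed
  finally show ?thesis by (simp add: algebra_simps)
qed

text \<open>From \<open>cmod p \<le> cmod q + 1\<close> the difference is at most
  \<open>ln (1 + 1 / cmod q)\<close>; exchanging \<open>p\<close> and \<open>q\<close> bounds the
  other sign, which is why both powers appear.\<close>

lemma abs_ln_ratio_le:
  fixes p q :: complex
  assumes "p \<noteq> 0" "q \<noteq> 0" "cmod (p - q) \<le> 1" "0 < a" "a < 1"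
  shows "\<bar>ln (cmod p) - ln (cmod q)\<bar> \<le> (1 + 1 / a) * (cmod q powr - a + cmod p powr - a)"
proof -
  have aux: "ln (cmod p) - ln (cmod q) \<le> (1 + 1 / a) * (cmod q powr - a)"
    if "p \<noteq> 0" "q \<noteq> 0" "cmod (p - q) \<le> 1" for p q :: complex
  proof -
    have "cmod p \<le> cmod q + 1" using that(3) norm_triangle_ineq2[of p q] by linarith
    hence "cmod p / cmod q \<le> 1 + 1 / cmod q" using that by (simp add: field_simps)
    hence "ln (cmod p / cmod q) \<le> ln (1 + 1 / cmod q)" using that by (intro ln_mono) auto
    also have "\<dots> \<le> (1 + 1 / a) * (1 / cmod q) powr a"
      using assms by (intro ln_one_plus_le_powr) auto
    also have "(1 / cmod q) powr a = cmod q powr - a" using that by (simp add: powr_divide powr_minus_divide)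
    finally show ?thesis using that by (simp add: ln_div)
  qed
  have "(1 + 1 / a) * (cmod q powr - a) \<ge> 0" "(1 + 1 / a) * (cmod p powr - a) \<ge> 0"
    using assms by auto
  moreover have "cmod (q - p) \<le> 1" using assms(3) by (simp add: norm_minus_commute)
  note aux[OF assms(1,2,3)] aux[OF assms(2,1) this]
  ultimately show ?thesis
    by (simp only: distrib_left abs_le_iff) linarith
qed

text \<open>The map from \<open>z\<close> to \<open>(z + v)\<^sup>2\<close> is at most two-to-one,
  so the set of exceptional \<open>z\<close> is still countable.\<close>

lemma AE_rcis_half_shift_square:
  assumes "r > 0" "eventually P (cosparse UNIV)"
  shows "AE \<theta> in angles. P ((rcis r (\<theta> / 2) + v)\<^sup>2)"
proof -
  define X where "X = {x. \<not> P x}"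
  have X: "countable X" unfolding X_def by (rule cosparse_imp_countable[OF assms(2)])
  have "countable ((\<lambda>x. csqrt x - v) ` X \<union> (\<lambda>x. - csqrt x - v) ` X)" using X by auto
  from AE_rcis_countable(2)[OF assms(1) this] show ?thesis
  proof eventually_elim
    case (elim \<theta>)
    define z where "z = rcis r (\<theta> / 2)"
    show ?case
    proof (rule ccontr)
      assume "\<not> P ((rcis r (\<theta> / 2) + v)\<^sup>2)"
      hence X: "(z + v)\<^sup>2 \<in> X" by (simp add: X_def z_def)
      have "csqrt ((z + v)\<^sup>2) = z + v \<or> csqrt ((z + v)\<^sup>2) = - (z + v)"
        by (metis power2_csqrt power2_eq_iff)
      hence "z = csqrt ((z + v)\<^sup>2) - v \<or> z = - csqrt ((z + v)\<^sup>2) - v" by auto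
      with X elim show False unfolding z_def by blast
    qed
  qed
qed

text \<open>Each of the two linear factors moves by exactly \<open>v\<close>, of length at most 1
  whatever the size of \<open>z\<close>. The four centres \<open>b\<close>, \<open>b - v\<close>,
  \<open>- b\<close> and \<open>- b - v\<close> are the points where an original or a shifted factor
  vanishes.\<close>

lemma ln_difference_pointwise:
  assumes a: "0 < a" "a < 1" and v: "cmod v \<le> 1" and c: "c = b\<^sup>2"
    and nz: "z\<^sup>2 \<noteq> c" "(z + v)\<^sup>2 \<noteq> c"
  shows "\<bar>ln (cmod ((z + v)\<^sup>2 - c)) - ln (cmod (z\<^sup>2 - c))\<bar> \<le>
     (1 + 1 / a) * (cmod (z - b) powr - a + cmod (z - (b - v)) powr - a +
       (cmod (z - (- b)) powr - a + cmod (z - (- b - v)) powr - a))"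
proof -
  have f: "z\<^sup>2 - c = (z - b) * (z - (- b))" "(z + v)\<^sup>2 - c = (z - (b - v)) * (z - (- b - v))"
    by (simp_all add: c power2_eq_square algebra_simps)
  have n: "z - b \<noteq> 0" "z - (-b) \<noteq> 0" "z - (b - v) \<noteq> 0" "z - (- b - v) \<noteq> 0"
    using nz f by (metis mult_zero_left mult_zero_right eq_iff_diff_eq_0)+
  have "\<bar>ln (cmod (z - (b - v))) - ln (cmod (z - b))\<bar> \<le> (1 + 1 / a) * (cmod (z - b) powr - a + cmod (z - (b - v)) powr - a)"
    using v n by (intro abs_ln_ratio_le a) auto
  moreover have "\<bar>ln (cmod (z - (- b - v))) - ln (cmod (z - (- b)))\<bar> \<le> (1 + 1 / a) * (cmod (z - (- b)) powr - a + cmod (z - (- b - v)) powr - a)"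
    using v n by (intro abs_ln_ratio_le a) auto
  moreover have "ln (cmod ((z + v)\<^sup>2 - c)) - ln (cmod (z\<^sup>2 - c)) =
     (ln (cmod (z - (b - v))) - ln (cmod (z - b))) + (ln (cmod (z - (- b - v))) - ln (cmod (z - (- b))))"
    unfolding f norm_mult using n by (simp add: ln_mult)
  ultimately show ?thesis unfolding distrib_left by linarith
qed

text \<open>\<open>K\<close> is chosen before \<open>h\<close> and \<open>r\<close>, so all
  dependence on zeros and poles sits in \<open>value_distribution_size\<close>. The majorant
  \<open>B\<close> remains a function of the angle so that the majorants of two shifts can be added.
  The points compared have modulus at most \<open>2 * r\<close>, at distance at least
  \<open>2 * r\<close> from the circle of radius \<open>4 * r\<close>; the factorization holds on a
  slightly larger disc.\<close>

lemma ln_difference_bound: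
  assumes a: "0 < a" "a < 1"
  obtains K where "K \<ge> 0"
    "\<And>h r v. nonzero_meromorphic h \<Longrightarrow> r \<ge> 4 \<Longrightarrow> cmod v = 1 / 2 \<Longrightarrow>
       \<exists>B. integrable angles B \<and>
         (AE \<theta> in angles. let z = rcis (sqrt r) (\<theta> / 2) in h (z\<^sup>2) \<noteq> 0 \<and> h ((z + v)\<^sup>2) \<noteq> 0 \<and>
            \<bar>ln (cmod (h ((z + v)\<^sup>2))) - ln (cmod (h (z\<^sup>2)))\<bar> \<le> B \<theta>) \<and>
         (LINT \<theta>|angles. B \<theta>) \<le>
            K * r powr (- a / 2) * (value_distribution_size (4 * r) h + value_distribution_size (5 * r) h)"
proof -
  obtain C1 where C1: "C1 \<ge> 0"
    "\<And>r b. r > 0 \<Longrightarrow> integrable angles (\<lambda>\<theta>. ln (cmod (rcis r \<theta> - b)))"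
    "\<And>r b. r > 0 \<Longrightarrow> cmod b \<le> 2 * r \<Longrightarrow> (LINT \<theta>|angles. \<bar>ln (cmod (rcis r \<theta> - b) / r)\<bar>) \<le> C1"
    using circle_ln_bound by blast
  obtain C2 where C2: "C2 \<ge> 0"
    "\<And>r b. r > 0 \<Longrightarrow> integrable angles (\<lambda>\<theta>. cmod (rcis r (\<theta> / 2) - b) powr - a)"
    "\<And>r b. r > 0 \<Longrightarrow> (LINT \<theta>|angles. cmod (rcis r (\<theta> / 2) - b) powr - a) \<le> C2 * r powr - a"
  proof (rule circle_powr_bound[OF a])
    fix C assume C: "C \<ge> 0"
      "\<And>r b. r > 0 \<Longrightarrow> integrable angles (\<lambda>\<theta>. cmod (rcis r (\<theta> / 2) - b) powr - a)"
      "\<And>r b. r > 0 \<Longrightarrow> (LINT \<theta>|angles. cmod (rcis r (\<theta> / 2) - b) powr - a) \<le> C * r powr - a"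
    show thesis by (rule that[OF C])
  qed
  \<comment> \<open>The first summand belongs to the harmonic part, with 2 pi for the proximities
    and \<open>C1\<close> per zero or pole; the second to the four powers in
    \<open>ln_difference_pointwise\<close>.\<close>
  define K where "K = 4 * (2 * pi + C1) + (1 + 1 / a) * (4 * C2)"
  show ?thesis
  proof (rule that[of K])
    show "K \<ge> 0" unfolding K_def using C1(1) C2(1) a by (intro add_nonneg_nonneg mult_nonneg_nonneg) auto
    fix h :: "complex \<Rightarrow> complex" and r :: real and v :: complex
    assume h: "nonzero_meromorphic h" and r: "r \<ge> 4" and v: "cmod v = 1 / 2"
    define s where "s = sqrt r"
    have s: "s \<ge> 2" "s * s = r" "s\<^sup>2 = r" using r real_sqrt_le_mono[OF r] by (auto simp: s_def)
    define Z where "Z = zeros_poles h (5 * r)"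
    have fin: "finite Z" unfolding Z_def by (rule finite_zeros_poles[OF h])
    obtain G where G: "G holomorphic_on ball 0 (5 * r)"
      "\<forall>\<^sub>\<approx>w. cmod w < 5 * r \<longrightarrow> h w \<noteq> 0 \<and> w \<notin> Z \<and>
         ln (cmod (h w)) = Re (G w) + (\<Sum>c\<in>Z. zorder h c * ln (cmod (w - c)))"
      using ln_meromorphic_factorization[OF h, of "5 * r"] unfolding Z_def by blast
    define G' where "G' = (\<lambda>w. G w + of_real (\<Sum>c\<in>Z. zorder h c * ln (4 * r)))"
    have G': "G' holomorphic_on ball 0 (5 * r)" unfolding G'_def by (intro holomorphic_intros G)
    define M where "M = (LINT \<theta>|angles. \<bar>Re (G' (rcis (4 * r) \<theta>))\<bar>)"
    define n where "n = (\<Sum>c\<in>Z. real_of_int \<bar>zorder h c\<bar>)"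
    define V where "V = value_distribution_size (4 * r) h + value_distribution_size (5 * r) h"
    note hi = nonzero_meromorphic_inverse(1)[OF h]
    have nn: "0 \<le> proximity (4 * r) h" "0 \<le> proximity (4 * r) (\<lambda>z. 1 / h z)"
      "0 \<le> proximity (5 * r) h" "0 \<le> proximity (5 * r) (\<lambda>z. 1 / h z)"
      "0 \<le> pole_count (4 * r) h" "0 \<le> pole_count (4 * r) (\<lambda>z. 1 / h z)"
      using h hi r by (auto intro!: proximity_nonneg pole_count_nonneg)
    have n: "n = pole_count (5 * r) h + pole_count (5 * r) (\<lambda>z. 1 / h z)"
      unfolding n_def Z_def by (rule sum_abs_zorder[OF h])
    have nV: "n \<le> V" and mV: "proximity (4 * r) h + proximity (4 * r) (\<lambda>z. 1 / h z) \<le> V"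
      and nmV: "proximity (4 * r) h + proximity (4 * r) (\<lambda>z. 1 / h z) + n \<le> V"
      unfolding V_def value_distribution_size_def n
      using nn pole_count_nonneg[OF h, of "5 * r"] pole_count_nonneg[OF hi, of "5 * r"] by linarith+
    have n0: "n \<ge> 0" unfolding n_def by (intro sum_nonneg) auto
    \<comment> \<open>\<open>Re G'\<close> is ln |h| minus the potentials \<open>?q\<close> weighted
      by the orders. The former is controlled in mean by the two proximities, each potential by
      \<open>C1\<close>.\<close>
    have MV: "M \<le> (2 * pi + C1) * V"
    proof -
      have r4: "4 * r > 0" "4 * r < 5 * r" using r by auto
      let ?q = "\<lambda>c \<theta>. ln (cmod (rcis (4 * r) \<theta> - c) / (4 * r))"
      have qi: "integrable angles (\<lambda>\<theta>. \<bar>?q c \<theta>\<bar>)" for c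
      proof -
        have "integrable angles (\<lambda>\<theta>. ln (cmod (rcis (4 * r) \<theta> - c)) - ln (4 * r))"
          using C1(2)[OF r4(1)] by (intro Bochner_Integration.integrable_diff) auto
        moreover have "AE \<theta> in angles. ln (cmod (rcis (4 * r) \<theta> - c)) - ln (4 * r) = ?q c \<theta>"
          using AE_rcis_neq[OF r4(1), of c] by eventually_elim (use r in \<open>auto simp: ln_div\<close>)
        moreover have "?q c \<in> borel_measurable angles" by (intro borel_measurable_angles) measurable
        ultimately have "integrable angles (?q c)" using integrable_cong_AE_imp by blast
        thus ?thesis by (rule integrable_abs)
      qed
      let ?m = "\<lambda>\<theta>. ln_plus (cmod (h (rcis (4 * r) \<theta>))) + ln_plus (cmod (1 / h (rcis (4 * r) \<theta>)))"
      have mi: "integrable angles ?m" by (intro Bochner_Integration.integrable_add circle_ln_plus(1) h hi r4)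
      have bi: "integrable angles (\<lambda>\<theta>. ?m \<theta> + (\<Sum>c\<in>Z. \<bar>zorder h c\<bar> * \<bar>?q c \<theta>\<bar>))"
        by (intro Bochner_Integration.integrable_add[OF mi] Bochner_Integration.integrable_sum integrable_mult_right qi)
      have "M \<le> (LINT \<theta>|angles. ?m \<theta> + (\<Sum>c\<in>Z. \<bar>zorder h c\<bar> * \<bar>?q c \<theta>\<bar>))"
        unfolding M_def
      proof (intro integral_mono_AE bi integrable_abs mean_value_Re(1)[OF G' r4])
        show "AE \<theta> in angles. \<bar>Re (G' (rcis (4 * r) \<theta>))\<bar> \<le> ?m \<theta> + (\<Sum>c\<in>Z. \<bar>zorder h c\<bar> * \<bar>?q c \<theta>\<bar>)"
          using AE_rcis_cosparse[OF r4(1) G(2)]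
        proof eventually_elim
          case (elim \<theta>)
          let ?w = "rcis (4 * r) \<theta>"
          have w: "h ?w \<noteq> 0" "?w \<notin> Z"
            "ln (cmod (h ?w)) = Re (G ?w) + (\<Sum>c\<in>Z. zorder h c * ln (cmod (?w - c)))"
            using elim r by auto
          have "(\<Sum>c\<in>Z. zorder h c * ?q c \<theta>) = (\<Sum>c\<in>Z. zorder h c * ln (cmod (?w - c)) - zorder h c * ln (4 * r))"
          proof (intro sum.cong refl)
            fix c assume "c \<in> Z"
            hence "?w - c \<noteq> 0" using w(2) by auto
            thus "zorder h c * ?q c \<theta> = zorder h c * ln (cmod (?w - c)) - zorder h c * ln (4 * r)"
              using r by (simp add: ln_div right_diff_distrib)
          qed
          hence "Re (G' ?w) = ln (cmod (h ?w)) - (\<Sum>c\<in>Z. zorder h c * ?q c \<theta>)"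
            unfolding w(3) sum_subtractf by (simp add: G'_def)
          hence "\<bar>Re (G' ?w)\<bar> \<le> \<bar>ln (cmod (h ?w))\<bar> + \<bar>\<Sum>c\<in>Z. zorder h c * ?q c \<theta>\<bar>" by linarith
          moreover have "\<bar>\<Sum>c\<in>Z. zorder h c * ?q c \<theta>\<bar> \<le> (\<Sum>c\<in>Z. \<bar>zorder h c\<bar> * \<bar>?q c \<theta>\<bar>)"
            by (rule order_trans[OF sum_abs]) (simp add: abs_mult)
          moreover have "\<bar>ln (cmod (h ?w))\<bar> \<le> ?m \<theta>"
            using ln_plus_inverse[OF norm_ge_zero, of "h ?w"] ln_plus_nonneg[of "cmod (h ?w)"] ln_plus_nonneg[of "1 / cmod (h ?w)"]
            by (simp only: norm_divide norm_one)
          ultimately show ?case by linarith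
        qed
      qed
      also have "\<dots> = 2 * pi * (proximity (4 * r) h + proximity (4 * r) (\<lambda>z. 1 / h z))
           + (\<Sum>c\<in>Z. \<bar>zorder h c\<bar> * (LINT \<theta>|angles. \<bar>?q c \<theta>\<bar>))"
        using circle_ln_plus[OF h r4(1)] circle_ln_plus[OF hi r4(1)]
        by (subst Bochner_Integration.integral_add[OF mi])
           (auto intro!: Bochner_Integration.integrable_sum integrable_mult_right qi
                 simp: Bochner_Integration.integral_sum integrable_mult_right qi distrib_left)
      also have "\<dots> \<le> 2 * pi * (proximity (4 * r) h + proximity (4 * r) (\<lambda>z. 1 / h z))
           + (\<Sum>c\<in>Z. \<bar>zorder h c\<bar> * C1)"
        using r by (intro add_left_mono sum_mono mult_left_mono C1(3) r4) (auto simp: Z_def zeros_poles_def)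
      also have "\<dots> = 2 * pi * (proximity (4 * r) h + proximity (4 * r) (\<lambda>z. 1 / h z)) + C1 * n"
        by (simp add: n_def sum_distrib_left mult_ac)
      also have "\<dots> \<le> 2 * pi * V + C1 * V"
        using mV nV C1(1) by (intro add_mono mult_left_mono) auto
      finally show ?thesis by (simp add: algebra_simps)
    qed
    have M0: "M \<ge> 0" unfolding M_def by (rule Bochner_Integration.integral_nonneg) simp
    \<comment> \<open>The Lipschitz constant \<open>M / (pi * r)\<close> of \<open>G'\<close> on the
      disc of radius \<open>2 * r\<close>, times the bound \<open>2 * s\<close> for the shift of
      \<open>z\<^sup>2\<close>, with \<open>r = s * s\<close>.\<close>
    define c0 where "c0 = 4 * M / (2 * pi * s)"
    define b where "b = csqrt"
    define E where "E = (\<lambda>c \<theta>. (1 + 1 / a) * (cmod (rcis s (\<theta> / 2) - b c) powr - a + cmod (rcis s (\<theta> / 2) - (b c - v)) powr - a +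
       (cmod (rcis s (\<theta> / 2) - (- b c)) powr - a + cmod (rcis s (\<theta> / 2) - (- b c - v)) powr - a)))"
    define B where "B = (\<lambda>\<theta>. c0 + (\<Sum>c\<in>Z. real_of_int \<bar>zorder h c\<bar> * E c \<theta>))"
    have s0: "s > 0" using s by simp
    have Ei: "integrable angles (E c)" for c
      unfolding E_def by (intro integrable_mult_right Bochner_Integration.integrable_add C2(2) s0)
    have EI: "(LINT \<theta>|angles. E c \<theta>) \<le> (1 + 1 / a) * (4 * C2) * s powr - a" for c
    proof -
      have "(LINT \<theta>|angles. E c \<theta>) = (1 + 1 / a) * ((LINT \<theta>|angles. cmod (rcis s (\<theta> / 2) - b c) powr - a) + (LINT \<theta>|angles. cmod (rcis s (\<theta> / 2) - (b c - v)) powr - a) +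
       ((LINT \<theta>|angles. cmod (rcis s (\<theta> / 2) - (- b c)) powr - a) + (LINT \<theta>|angles. cmod (rcis s (\<theta> / 2) - (- b c - v)) powr - a)))"
        unfolding E_def
        by (simp only: integral_mult_right_zero Bochner_Integration.integral_add Bochner_Integration.integrable_add C2(2)[OF s0])
      also have "\<dots> \<le> (1 + 1 / a) * ((C2 * s powr - a + C2 * s powr - a) + (C2 * s powr - a + C2 * s powr - a))"
        using a by (intro mult_left_mono add_mono C2(3) s0) auto
      finally show ?thesis by (simp add: algebra_simps)
    qed
    have Bi: "integrable angles B" unfolding B_def
      by (intro Bochner_Integration.integrable_add Bochner_Integration.integrable_sum integrable_mult_right Ei integrable_angles_const)
    have sa: "s powr - a = r powr (- a / 2)"
      using r by (simp add: s_def powr_half_sqrt[symmetric] powr_powr)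
    \<comment> \<open>The harmonic part gains the full factor \<open>1 / s\<close>, weakened here to
      the gain of the singular part so that both share one exponent.\<close>
    have s1: "1 / s \<le> s powr - a"
    proof -
      have "s powr - 1 \<le> s powr - a" using s a by (intro powr_mono) auto
      thus ?thesis using s0 by (simp add: powr_minus_divide)
    qed
    have "(LINT \<theta>|angles. B \<theta>) = 2 * pi * c0 + (\<Sum>c\<in>Z. \<bar>zorder h c\<bar> * (LINT \<theta>|angles. E c \<theta>))"
      unfolding B_def using Ei by (subst Bochner_Integration.integral_add) (auto simp: Bochner_Integration.integral_sum)
    moreover have "2 * pi * c0 = 4 * M * (1 / s)" by (simp add: c0_def)
    moreover have "4 * M * (1 / s) \<le> 4 * ((2 * pi + C1) * V) * (s powr - a)"
      using MV M0 s1 s0 C1(1) by (intro mult_mono) auto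
    moreover have "(\<Sum>c\<in>Z. \<bar>zorder h c\<bar> * (LINT \<theta>|angles. E c \<theta>)) \<le> V * ((1 + 1 / a) * (4 * C2) * s powr - a)"
    proof -
      have "(\<Sum>c\<in>Z. \<bar>zorder h c\<bar> * (LINT \<theta>|angles. E c \<theta>)) \<le> (\<Sum>c\<in>Z. \<bar>zorder h c\<bar> * ((1 + 1 / a) * (4 * C2) * s powr - a))"
        by (intro sum_mono mult_left_mono EI) auto
      also have "\<dots> = n * ((1 + 1 / a) * (4 * C2) * s powr - a)" by (simp add: n_def sum_distrib_right)
      also have "\<dots> \<le> V * ((1 + 1 / a) * (4 * C2) * s powr - a)"
        using nV C2(1) a by (intro mult_right_mono mult_nonneg_nonneg) auto
      finally show ?thesis .
    qed
    moreover have "4 * ((2 * pi + C1) * V) * (s powr - a) + V * ((1 + 1 / a) * (4 * C2) * s powr - a) = K * s powr - a * V"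
      unfolding K_def by (simp only: distrib_left distrib_right mult_ac add_ac)
    ultimately have BI: "(LINT \<theta>|angles. B \<theta>) \<le> K * r powr (- a / 2) * V"
      unfolding sa by linarith
    have main: "AE \<theta> in angles. let z = rcis (sqrt r) (\<theta> / 2) in h (z\<^sup>2) \<noteq> 0 \<and> h ((z + v)\<^sup>2) \<noteq> 0 \<and>
            \<bar>ln (cmod (h ((z + v)\<^sup>2))) - ln (cmod (h (z\<^sup>2)))\<bar> \<le> B \<theta>"
      using AE_rcis_half_shift_square[OF s0 G(2), of 0] AE_rcis_half_shift_square[OF s0 G(2), of v]
    proof eventually_elim
      case (elim \<theta>)
      define z where "z = rcis s (\<theta> / 2)"
      have zs: "cmod z = s" using s0 by (simp add: z_def)
      have z2: "cmod (z\<^sup>2) = r" by (simp add: norm_power zs s)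
      have "cmod (z + v) \<le> s + 1 / 2" using norm_triangle_ineq[of z v] by (simp add: zs v)
      hence "cmod ((z + v)\<^sup>2) \<le> (s + 1 / 2)\<^sup>2" unfolding norm_power by (intro power_mono) auto
      moreover have "(s + 1 / 2)\<^sup>2 = r + s + 1 / 4" by (simp add: power2_eq_square algebra_simps s)
      \<comment> \<open>Here \<open>r \<ge> 4\<close> enters: \<open>s \<ge> 2\<close> gives
        \<open>s + 1 / 4 \<le> 2 * s \<le> s * s\<close>.\<close>
      moreover have "s + 1 / 4 \<le> r" using mult_right_mono[OF s(1), of s] s by linarith
      ultimately have zv2: "cmod ((z + v)\<^sup>2) \<le> 2 * r" by linarith
      have x: "h (z\<^sup>2) \<noteq> 0" "z\<^sup>2 \<notin> Z"
        "ln (cmod (h (z\<^sup>2))) = Re (G (z\<^sup>2)) + (\<Sum>c\<in>Z. zorder h c * ln (cmod (z\<^sup>2 - c)))"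
      proof -
        have "cmod (z\<^sup>2) < 5 * r" using z2 r by simp
        from mp[OF elim(1)[folded z_def, unfolded add_0_right] this]
        show "h (z\<^sup>2) \<noteq> 0" "z\<^sup>2 \<notin> Z"
          "ln (cmod (h (z\<^sup>2))) = Re (G (z\<^sup>2)) + (\<Sum>c\<in>Z. zorder h c * ln (cmod (z\<^sup>2 - c)))" by blast+
      qed
      have x': "h ((z + v)\<^sup>2) \<noteq> 0" "(z + v)\<^sup>2 \<notin> Z"
        "ln (cmod (h ((z + v)\<^sup>2))) = Re (G ((z + v)\<^sup>2)) + (\<Sum>c\<in>Z. zorder h c * ln (cmod ((z + v)\<^sup>2 - c)))"
      proof -
        have "cmod ((z + v)\<^sup>2) < 5 * r" using zv2 r by simp
        from mp[OF elim(2)[folded z_def] this]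
        show "h ((z + v)\<^sup>2) \<noteq> 0" "(z + v)\<^sup>2 \<notin> Z"
          "ln (cmod (h ((z + v)\<^sup>2))) = Re (G ((z + v)\<^sup>2)) + (\<Sum>c\<in>Z. zorder h c * ln (cmod ((z + v)\<^sup>2 - c)))" by blast+
      qed
        \<comment> \<open>\<open>G'\<close> differs from \<open>G\<close> by a real constant, so the zero and pole factors may be rescaled by
        \<open>4 * r\<close> without changing the difference; this keeps \<open>M\<close> free of a factor \<open>ln r\<close>.\<close>
      have GG: "\<bar>Re (G ((z + v)\<^sup>2)) - Re (G (z\<^sup>2))\<bar> \<le> c0"
      proof -
        have d: "cmod (deriv G' w) \<le> M / (pi * r)" if w: "cmod w \<le> 2 * r" for w
        proof -
          have "cmod (deriv G' w) \<le> 4 * r / (pi * (4 * r - cmod w)\<^sup>2) * M"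
            unfolding M_def using w r by (intro deriv_bound_Re[OF G']) auto
          moreover have "(2 * r)\<^sup>2 \<le> (4 * r - cmod w)\<^sup>2" using w r by (intro power_mono) auto
          hence "4 * r / (pi * (4 * r - cmod w)\<^sup>2) \<le> 4 * r / (pi * (2 * r)\<^sup>2)"
            using w r by (intro divide_left_mono mult_left_mono mult_pos_pos zero_less_power) auto
          hence "4 * r / (pi * (4 * r - cmod w)\<^sup>2) * M \<le> 4 * r / (pi * (2 * r)\<^sup>2) * M"
            using M0 by (rule mult_right_mono)
          moreover have "4 * r / (pi * (2 * r)\<^sup>2) * M = M / (pi * r)" using r by (simp add: power2_eq_square)
          ultimately show ?thesis by linarith
        qed
        have lip: "cmod (G' ((z + v)\<^sup>2) - G' (z\<^sup>2)) \<le> (M / (pi * r)) * cmod ((z + v)\<^sup>2 - z\<^sup>2)"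
        proof (rule field_differentiable_bound[of "cball 0 (2 * r)" G' "deriv G'"])
          fix w :: complex assume w: "w \<in> cball 0 (2 * r)"
          hence "w \<in> ball 0 (5 * r)" using r by auto
          thus "(G' has_field_derivative deriv G' w) (at w within cball 0 (2 * r))"
            using holomorphic_derivI[OF G' open_ball] has_field_derivative_at_within by blast
          show "cmod (deriv G' w) \<le> M / (pi * r)" using w by (intro d) auto
        next
          show "(z + v)\<^sup>2 \<in> cball 0 (2 * r)" using zv2 by simp
          show "z\<^sup>2 \<in> cball 0 (2 * r)" unfolding mem_cball_0 z2 using r by simp
        qed simp
        have e: "(z + v)\<^sup>2 - z\<^sup>2 = 2 * z * v + v\<^sup>2" by (simp add: power2_eq_square algebra_simps)
        have "cmod (2 * z * v) = s" "cmod (v\<^sup>2) = 1 / 4" by (simp_all add: norm_mult norm_power zs v power2_eq_square)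
        hence "cmod (2 * z * v + v\<^sup>2) \<le> 2 * s"
          using norm_triangle_ineq[of "2 * z * v" "v\<^sup>2"] s(1) by linarith
        hence "M / (pi * r) * cmod (2 * z * v + v\<^sup>2) \<le> M / (pi * r) * (2 * s)"
          using M0 r by (intro mult_left_mono) auto
        also have "M / (pi * r) * (2 * s) = c0" unfolding c0_def s(2)[symmetric] using s0 by simp
        finally have *: "cmod (G' ((z + v)\<^sup>2) - G' (z\<^sup>2)) \<le> c0" using lip unfolding e by linarith
        have "Re (G ((z + v)\<^sup>2)) - Re (G (z\<^sup>2)) = Re (G' ((z + v)\<^sup>2) - G' (z\<^sup>2))" by (simp add: G'_def)
        thus ?thesis using * abs_Re_le_cmod[of "G' ((z + v)\<^sup>2) - G' (z\<^sup>2)"] by linarith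
      qed
      have eq: "ln (cmod (h ((z + v)\<^sup>2))) - ln (cmod (h (z\<^sup>2))) = (Re (G ((z + v)\<^sup>2)) - Re (G (z\<^sup>2))) +
         (\<Sum>c\<in>Z. zorder h c * (ln (cmod ((z + v)\<^sup>2 - c)) - ln (cmod (z\<^sup>2 - c))))"
        unfolding x(3) x'(3) right_diff_distrib sum_subtractf by simp
      have "\<bar>ln (cmod (h ((z + v)\<^sup>2))) - ln (cmod (h (z\<^sup>2)))\<bar> \<le> B \<theta>"
        unfolding eq B_def
      proof (rule order_trans[OF abs_triangle_ineq], intro add_mono GG order_trans[OF sum_abs] sum_mono)
        fix c assume c: "c \<in> Z"
        have "\<bar>ln (cmod ((z + v)\<^sup>2 - c)) - ln (cmod (z\<^sup>2 - c))\<bar> \<le> E c \<theta>"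
          unfolding E_def z_def[symmetric] using c x(2) x'(2) v
          by (intro ln_difference_pointwise a) (auto simp: b_def)
        thus "\<bar>zorder h c * (ln (cmod ((z + v)\<^sup>2 - c)) - ln (cmod (z\<^sup>2 - c)))\<bar> \<le> \<bar>zorder h c\<bar> * E c \<theta>"
          by (simp add: abs_mult mult_left_mono)
      qed
      thus ?case using x(1) x'(1) unfolding Let_def s_def[symmetric] z_def[symmetric] by blast
    qed
    show "\<exists>B. integrable angles B \<and>
         (AE \<theta> in angles. let z = rcis (sqrt r) (\<theta> / 2) in h (z\<^sup>2) \<noteq> 0 \<and> h ((z + v)\<^sup>2) \<noteq> 0 \<and>
            \<bar>ln (cmod (h ((z + v)\<^sup>2))) - ln (cmod (h (z\<^sup>2)))\<bar> \<le> B \<theta>) \<and>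
         (LINT \<theta>|angles. B \<theta>) \<le>
            K * r powr (- a / 2) * (value_distribution_size (4 * r) h + value_distribution_size (5 * r) h)"
      using Bi main BI unfolding V_def by blast
  qed
qed

section \<open>The Wilson operator on meromorphic functions\<close>

text \<open>Lets one logarithmic difference estimate, applied to \<open>f - c\<close>, bound all
  quotients with the same numerator.\<close>

lemma wilson_diff_const: "wilson (\<lambda>x. f x - c) = wilson f"
  by (auto simp: wilson_def wilson_quotient_def fun_eq_iff)

lemma wilson_quotient_meromorphic:
  assumes "f meromorphic_on UNIV"
  shows "wilson_quotient f meromorphic_on UNIV"
proof -
  have "(\<lambda>z. f ((z + \<i> / 2)\<^sup>2)) meromorphic_on UNIV" "(\<lambda>z. f ((z - \<i> / 2)\<^sup>2)) meromorphic_on UNIV"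
    by (rule meromorphic_on_compose[OF assms]; auto intro!: analytic_intros)+
  hence "(\<lambda>z. (f ((z + \<i> / 2)\<^sup>2) - f ((z - \<i> / 2)\<^sup>2)) / (2 * \<i> * z)) meromorphic_on UNIV"
    by (intro meromorphic_intros)
  thus ?thesis by (simp add: wilson_quotient_def[abs_def])
qed

text \<open>\<open>csqrt\<close> is not analytic on its branch cut; dividing by \<open>x0\<close>
  moves the point to 1, away from the cut.\<close>

lemma local_sqrt:
  fixes x0 :: complex
  assumes "x0 \<noteq> 0"
  obtains \<zeta> where "\<zeta> analytic_on {x0}" "\<And>x. (\<zeta> x)\<^sup>2 = x"
proof
  show "(\<lambda>x. csqrt x0 * csqrt (x / x0)) analytic_on {x0}"
    by (intro analytic_intros) (use assms in auto)
  show "(csqrt x0 * csqrt (x / x0))\<^sup>2 = x" for x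
    using assms by (simp add: power_mult_distrib)
qed

text \<open>Away from 0 the operator is the quotient composed with a local analytic root. At 0 there
  is none; there the singularity is isolated, by local roots at the nearby points, and not
  essential, because \<open>csqrt\<close> tends to 0 and a limit or pole of the quotient at 0
  carries over.\<close>

lemma wilson_meromorphic:
  assumes "f meromorphic_on UNIV"
  shows "wilson f meromorphic_on UNIV"
  unfolding meromorphic_on_altdef
proof safe
  fix x0 :: complex
  let ?Q = "wilson_quotient f"
  have Q: "?Q meromorphic_on A" for A
    using wilson_quotient_meromorphic[OF assms] by (rule meromorphic_on_subset) auto
  have eq: "\<forall>\<^sub>F x in nhds x1. wilson f x = ?Q (\<zeta> x)" if "x1 \<noteq> 0" "\<And>x. (\<zeta> x)\<^sup>2 = x" for \<zeta> x1
  proof -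
    have "\<forall>\<^sub>F x in nhds x1. x \<noteq> 0" using that(1) by (rule t1_space_nhds)
    thus ?thesis by eventually_elim (use that(2) wilson_eq_quotient in blast)
  qed
  have "wilson f meromorphic_on {x0}"
  proof (cases "x0 = 0")
    case False
    then obtain \<zeta> where \<zeta>: "\<zeta> analytic_on {x0}" "\<And>x. (\<zeta> x)\<^sup>2 = x" using local_sqrt by blast
    have "(\<lambda>x. ?Q (\<zeta> x)) meromorphic_on {x0}" by (rule meromorphic_on_compose[OF Q \<zeta>(1)]) auto
    moreover have "\<forall>\<^sub>F x in at x0. wilson f x = ?Q (\<zeta> x)"
      using eq[OF False \<zeta>(2)] by (simp add: eventually_nhds_conv_at)
    ultimately show ?thesis by (subst meromorphic_on_cong[where g = "\<lambda>x. ?Q (\<zeta> x)"]) auto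
  next
    case True
    have iso: "isolated_singularity_at ?Q 0" "not_essential ?Q 0"
      using Q[of UNIV] by (auto simp: meromorphic_on_altdef)
    obtain \<rho> where \<rho>: "\<rho> > 0" "?Q analytic_on ball 0 \<rho> - {0}"
      using iso(1) by (auto simp: isolated_singularity_at_def)
    \<comment> \<open>The radius is squared because a root of \<open>x1\<close> must land in the
      ball of radius \<open>\<rho>\<close>.\<close>
    have "wilson f analytic_on {x1}" if x1: "x1 \<in> ball 0 (\<rho>\<^sup>2) - {0}" for x1
    proof -
      obtain \<zeta> where \<zeta>: "\<zeta> analytic_on {x1}" "\<And>x. (\<zeta> x)\<^sup>2 = x" using local_sqrt x1 by blast
      have "(cmod (\<zeta> x1))\<^sup>2 < \<rho>\<^sup>2" using x1 \<zeta>(2)[of x1] by (metis DiffD1 mem_ball_0 norm_power)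
      hence "cmod (\<zeta> x1) < \<rho>" using \<rho>(1) by (intro power_less_imp_less_base[of _ 2 \<rho>]) auto
      moreover have "\<zeta> x1 \<noteq> 0" using \<zeta>(2)[of x1] x1 by auto
      ultimately have "?Q analytic_on {\<zeta> x1}" by (intro analytic_on_subset[OF \<rho>(2)]) auto
      hence "(?Q \<circ> \<zeta>) analytic_on {x1}" by (intro analytic_on_compose \<zeta>) auto
      hence "(\<lambda>x. ?Q (\<zeta> x)) analytic_on {x1}" by (simp add: o_def)
      thus ?thesis using analytic_at_cong[OF eq[OF _ \<zeta>(2)]] x1 by auto
    qed
    hence "wilson f analytic_on ball 0 (\<rho>\<^sup>2) - {0}" using analytic_on_analytic_at by blast
    hence i: "isolated_singularity_at (wilson f) 0"
      unfolding isolated_singularity_at_def using \<rho>(1) by (intro exI[of _ "\<rho>\<^sup>2"]) auto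
    have ev: "\<forall>\<^sub>F x in at 0. wilson f x = ?Q (csqrt x)"
      by (auto simp: eventually_at_filter wilson_def)
    have ev0: "\<forall>\<^sub>F x in at 0. csqrt x \<noteq> 0"
      by (auto simp: eventually_at_filter)
    have lim: "csqrt \<midarrow>0\<rightarrow> 0"
    proof (rule tendsto_norm_zero_cancel)
      have "((\<lambda>x::complex. sqrt (cmod x)) \<longlongrightarrow> sqrt (cmod 0)) (at 0)" by (intro tendsto_intros)
      thus "((\<lambda>x. cmod (csqrt x)) \<longlongrightarrow> 0) (at 0)" by simp
    qed
    have "not_essential (\<lambda>x. ?Q (csqrt x)) 0"
    proof (cases "is_pole ?Q 0")
      case True
      from is_pole_compose[OF this lim ev0] show ?thesis by (auto simp: not_essential_def)
    next
      case False
      then obtain c where "?Q \<midarrow>0\<rightarrow> c" using iso(2) by (auto simp: not_essential_def)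
      from filterlim_compose[OF this, of csqrt "at 0"] lim ev0
      have "(\<lambda>x. ?Q (csqrt x)) \<midarrow>0\<rightarrow> c" by (auto simp: filterlim_at)
      thus ?thesis by (auto simp: not_essential_def)
    qed
    hence "not_essential (wilson f) 0" using not_essential_cong[OF ev refl] by simp
    with i show ?thesis using True by (simp add: meromorphic_at_iff)
  qed
  thus "isolated_singularity_at (wilson f) x0" "not_essential (wilson f) x0"
    by (auto simp: meromorphic_at_iff)
qed

text \<open>A meromorphic function on the connected plane either vanishes off a sparse set, which
  here means membership in the kernel, or is nonzero off a sparse set.\<close>

lemma nonzero_meromorphic_wilson:
  assumes "f meromorphic_on UNIV" "f \<notin> wilson_kernel"
  shows "nonzero_meromorphic (wilson f)"
  using meromorphic_imp_constant_or_avoid[OF wilson_meromorphic[OF assms(1)] open_UNIV connected_UNIV, of 0]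
    wilson_meromorphic[OF assms(1)] assms(2)
  by (auto simp: nonzero_meromorphic_def wilson_kernel_def)

text \<open>If \<open>f = c\<close> off a sparse set, then for almost every angle both shifted
  squares avoid that set and the quotient vanishes, against the nonvanishing of
  \<open>wilson f\<close> off a sparse set.\<close>

lemma nonzero_meromorphic_diff_const:
  assumes "f meromorphic_on UNIV" "f \<notin> wilson_kernel"
  shows "nonzero_meromorphic (\<lambda>x. f x - c)"
proof -
  have m: "(\<lambda>x. f x - c) meromorphic_on UNIV" by (intro meromorphic_intros assms)
  have "\<not> (\<forall>\<^sub>\<approx>x. f x - c = 0)"
  proof
    assume ev: "\<forall>\<^sub>\<approx>x. f x - c = 0"
    have W: "\<forall>\<^sub>\<approx>x. wilson f x \<noteq> 0"
      using nonzero_meromorphic_wilson[OF assms] by (simp add: nonzero_meromorphic_def)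
    \<comment> \<open>An absurd statement for almost every angle is contradictory because the angles
      have positive total mass.\<close>
    have "AE \<theta> in angles. (0::real) = 1"
      using AE_rcis_half_shift_square[OF zero_less_one ev, of "\<i> / 2"]
        AE_rcis_half_shift_square[OF zero_less_one ev, of "- \<i> / 2"]
        AE_rcis_half_shift_square[OF zero_less_one W, of 0]
    proof eventually_elim
      case (elim \<theta>)
      define z where "z = rcis 1 (\<theta> / 2)"
      have "z\<^sup>2 \<noteq> 0" by (simp add: z_def rcis_def)
      hence "wilson f (z\<^sup>2) = wilson_quotient f z" by (rule wilson_eq_quotient) simp
      also have "\<dots> = 0" using elim(1,2) unfolding z_def[symmetric] by (simp add: wilson_quotient_def)
      finally show ?case using elim(3) by (simp add: z_def)
    qed
    hence "(LINT \<theta>|angles. (0::real)) = (LINT \<theta>|angles. (1::real))" by (intro integral_cong_AE) auto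
    thus False by simp
  qed
  thus ?thesis
    using meromorphic_imp_constant_or_avoid[OF m open_UNIV connected_UNIV, of 0] m
    by (auto simp: nonzero_meromorphic_def)
qed

section \<open>The proximity of the logarithmic difference quotient\<close>

lemma nonzero_meromorphic_divide:
  assumes "nonzero_meromorphic f" "nonzero_meromorphic g"
  shows "nonzero_meromorphic (\<lambda>x. f x / g x)"
proof -
  have "\<forall>\<^sub>\<approx>x. f x / g x \<noteq> 0"
    using nonzero_meromorphicD(6)[OF assms(1)] nonzero_meromorphicD(6)[OF assms(2)] by eventually_elim auto
  moreover have "(\<lambda>x. f x / g x) meromorphic_on UNIV"
    by (intro meromorphic_intros nonzero_meromorphicD(1) assms)
  ultimately show ?thesis unfolding nonzero_meromorphic_def by blast
qed

lemma ln_plus_ratio_le: "0 < x \<Longrightarrow> 0 < y \<Longrightarrow> ln_plus (x / y) \<le> \<bar>ln x - ln y\<bar>"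
  using ln_plus_le_abs_ln[of "x / y"] by (simp add: ln_div)

text \<open>For \<open>cmod z \<ge> 1\<close> the denominator has modulus at least 2 and turns the
  sum of two moduli into at most their average, hence at most their maximum. So no additive
  \<open>ln 2\<close> arises; the bound in \<open>wilson_log_difference\<close> may tend to 0 and
  could not absorb it.\<close>

lemma wilson_ln_plus_le:
  assumes "cmod z \<ge> 1" "h (z\<^sup>2) \<noteq> 0" "h ((z + \<i> / 2)\<^sup>2) \<noteq> 0" "h ((z - \<i> / 2)\<^sup>2) \<noteq> 0"
  shows "ln_plus (cmod (wilson h (z\<^sup>2) / h (z\<^sup>2))) \<le>
    \<bar>ln (cmod (h ((z + \<i> / 2)\<^sup>2))) - ln (cmod (h (z\<^sup>2)))\<bar> +
    \<bar>ln (cmod (h ((z - \<i> / 2)\<^sup>2))) - ln (cmod (h (z\<^sup>2)))\<bar>"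
proof -
  define p m q where "p = cmod (h ((z + \<i> / 2)\<^sup>2))" and "m = cmod (h ((z - \<i> / 2)\<^sup>2))" and "q = cmod (h (z\<^sup>2))"
  have pos: "p > 0" "m > 0" "q > 0" using assms by (auto simp: p_def m_def q_def)
  have "z\<^sup>2 \<noteq> 0" using assms(1) by auto
  hence "wilson h (z\<^sup>2) = wilson_quotient h z" by (rule wilson_eq_quotient) simp
  hence "cmod (wilson h (z\<^sup>2) / h (z\<^sup>2)) = cmod (h ((z + \<i> / 2)\<^sup>2) - h ((z - \<i> / 2)\<^sup>2)) / (2 * cmod z * q)"
    by (simp add: wilson_quotient_def norm_divide norm_mult q_def)
  also have "\<dots> \<le> (p + m) / (2 * 1 * q)"
    unfolding p_def m_def using assms(1) pos
    by (intro frac_le norm_triangle_ineq4 mult_right_mono mult_left_mono) auto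
  also have "\<dots> = (p / q + m / q) / 2" using pos by (simp add: field_simps)
  also have "(p / q + m / q) / 2 \<le> max (p / q) (m / q)"
  proof -
    have "(u + v) / 2 \<le> max u v" for u v :: real by (auto simp: max_def)
    thus ?thesis .
  qed
  finally have "ln_plus (cmod (wilson h (z\<^sup>2) / h (z\<^sup>2))) \<le> ln_plus (max (p / q) (m / q))" by (rule ln_plus_mono)
  also have "\<dots> \<le> ln_plus (p / q) + ln_plus (m / q)" by (auto simp: max_def)
  also have "\<dots> \<le> \<bar>ln p - ln q\<bar> + \<bar>ln m - ln q\<bar>" by (intro add_mono ln_plus_ratio_le pos)
  finally show ?thesis by (simp add: p_def m_def q_def)
qed

lemma wilson_log_difference:
  assumes h: "nonzero_meromorphic h" "nonzero_meromorphic (wilson h)"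
    and \<rho>: "\<rho> \<ge> 0" and K: "K \<ge> 0"
    and T: "\<forall>\<^sub>F r in at_top. nevanlinna_char r h \<le> K * r powr \<rho>"
    and \<eta>: "0 < \<eta>" "\<eta> < 1 / 2"
  obtains K' where "K' \<ge> 0"
    "\<forall>\<^sub>F r in at_top. proximity r (\<lambda>x. wilson h x / h x) \<le> K' * r powr (\<rho> - 1 / 2 + \<eta>)"
proof -
  \<comment> \<open>So that \<open>- a / 2 = - 1 / 2 + \<eta>\<close>.\<close>
  define a where "a = 1 - 2 * \<eta>"
  have a: "0 < a" "a < 1" using \<eta> by (auto simp: a_def)
  obtain K1 where K1: "K1 \<ge> 0"
    "\<And>h r v. nonzero_meromorphic h \<Longrightarrow> r \<ge> 4 \<Longrightarrow> cmod v = 1 / 2 \<Longrightarrow>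
       \<exists>B. integrable angles B \<and>
         (AE \<theta> in angles. let z = rcis (sqrt r) (\<theta> / 2) in h (z\<^sup>2) \<noteq> 0 \<and> h ((z + v)\<^sup>2) \<noteq> 0 \<and>
            \<bar>ln (cmod (h ((z + v)\<^sup>2))) - ln (cmod (h (z\<^sup>2)))\<bar> \<le> B \<theta>) \<and>
         (LINT \<theta>|angles. B \<theta>) \<le>
            K1 * r powr (- a / 2) * (value_distribution_size (4 * r) h + value_distribution_size (5 * r) h)"
    using ln_difference_bound[OF a] by blast
  obtain K2 where K2: "K2 \<ge> 0" "\<forall>\<^sub>F r in at_top. value_distribution_size r h \<le> K2 * r powr \<rho>"
    using value_distribution_size_bound[OF h(1) \<rho> K T] by blast
  have "filterlim (\<lambda>r::real. 4 * r) at_top at_top" "filterlim (\<lambda>r::real. 5 * r) at_top at_top"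
    by real_asymp+
  note V = this[THEN eventually_compose_filterlim[OF K2(2)]]
  \<comment> \<open>Two shifts, the radii \<open>4 * r\<close> and \<open>5 * r\<close>, and the
    division by 2 pi in \<open>proximity\<close>.\<close>
  define K' where "K' = 2 * (K1 * (K2 * 4 powr \<rho> + K2 * 5 powr \<rho>)) / (2 * pi)"
  have "\<forall>\<^sub>F r in at_top. proximity r (\<lambda>x. wilson h x / h x) \<le> K' * r powr (\<rho> - 1 / 2 + \<eta>)"
    using V eventually_ge_at_top[of 4]
  proof eventually_elim
    case (elim r)
    have r: "r \<ge> 4" "r > 0" using elim by auto
    have W: "nonzero_meromorphic (\<lambda>x. wilson h x / h x)" by (rule nonzero_meromorphic_divide[OF h(2,1)])
    define X where "X = K1 * r powr (- a / 2) * (value_distribution_size (4 * r) h + value_distribution_size (5 * r) h)"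
    have v: "cmod (\<i> / 2) = 1 / 2" "cmod (- \<i> / 2) = 1 / 2" by (simp_all add: norm_divide)
    obtain B1 where B1: "integrable angles B1"
         "AE \<theta> in angles. let z = rcis (sqrt r) (\<theta> / 2) in h (z\<^sup>2) \<noteq> 0 \<and> h ((z + \<i> / 2)\<^sup>2) \<noteq> 0 \<and>
            \<bar>ln (cmod (h ((z + \<i> / 2)\<^sup>2))) - ln (cmod (h (z\<^sup>2)))\<bar> \<le> B1 \<theta>"
         "(LINT \<theta>|angles. B1 \<theta>) \<le> X"
      using K1(2)[OF h(1) r(1) v(1)] unfolding X_def by blast
    obtain B2 where B2: "integrable angles B2"
         "AE \<theta> in angles. let z = rcis (sqrt r) (\<theta> / 2) in h (z\<^sup>2) \<noteq> 0 \<and> h ((z + - \<i> / 2)\<^sup>2) \<noteq> 0 \<and>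
            \<bar>ln (cmod (h ((z + - \<i> / 2)\<^sup>2))) - ln (cmod (h (z\<^sup>2)))\<bar> \<le> B2 \<theta>"
         "(LINT \<theta>|angles. B2 \<theta>) \<le> X"
      using K1(2)[OF h(1) r(1) v(2)] unfolding X_def by blast
    have "2 * pi * proximity r (\<lambda>x. wilson h x / h x) =
       (LINT \<theta>|angles. ln_plus (cmod (wilson h (rcis r \<theta>) / h (rcis r \<theta>))))"
      by (rule circle_ln_plus(2)[OF W r(2)])
    also have "\<dots> \<le> (LINT \<theta>|angles. B1 \<theta> + B2 \<theta>)"
    proof (intro integral_mono_AE circle_ln_plus(1)[OF W r(2)] Bochner_Integration.integrable_add B1 B2)
      show "AE \<theta> in angles. ln_plus (cmod (wilson h (rcis r \<theta>) / h (rcis r \<theta>))) \<le> B1 \<theta> + B2 \<theta>"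
        using B1(2) B2(2)
      proof eventually_elim
        case (elim \<theta>)
        define z where "z = rcis (sqrt r) (\<theta> / 2)"
        have z2: "z\<^sup>2 = rcis r \<theta>"
          using r by (simp add: z_def power2_eq_square rcis_mult)
        have m: "z + - \<i> / 2 = z - \<i> / 2" by simp
        have "1 \<le> sqrt r" using r by simp
        hence z1: "cmod z \<ge> 1" by (simp add: z_def)
        note e = elim[unfolded Let_def, folded z_def, unfolded m]
        have "ln_plus (cmod (wilson h (z\<^sup>2) / h (z\<^sup>2))) \<le>
          \<bar>ln (cmod (h ((z + \<i> / 2)\<^sup>2))) - ln (cmod (h (z\<^sup>2)))\<bar> +
          \<bar>ln (cmod (h ((z - \<i> / 2)\<^sup>2))) - ln (cmod (h (z\<^sup>2)))\<bar>"
          using e by (intro wilson_ln_plus_le z1) auto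
        also have "\<dots> \<le> B1 \<theta> + B2 \<theta>" using e by (intro add_mono) auto
        finally show ?case by (simp only: z2)
      qed
    qed
    also have "\<dots> \<le> 2 * X" using B1 B2 by simp
    finally have pX: "2 * pi * proximity r (\<lambda>x. wilson h x / h x) \<le> 2 * X" .
    have "X \<le> K1 * r powr (- a / 2) * (K2 * (4 * r) powr \<rho> + K2 * (5 * r) powr \<rho>)"
      unfolding X_def using elim K1(1) by (intro mult_left_mono add_mono) auto
    also have "\<dots> = K1 * (K2 * 4 powr \<rho> + K2 * 5 powr \<rho>) * (r powr (- a / 2) * r powr \<rho>)"
      using r by (simp add: powr_mult algebra_simps)
    also have "r powr (- a / 2) * r powr \<rho> = r powr (\<rho> - 1 / 2 + \<eta>)"
      using r by (simp add: a_def powr_add[symmetric] field_simps)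
    finally have "2 * pi * proximity r (\<lambda>x. wilson h x / h x) \<le> 2 * (K1 * (K2 * 4 powr \<rho> + K2 * 5 powr \<rho>) * r powr (\<rho> - 1 / 2 + \<eta>))"
      using pX by linarith
    also have "\<dots> = 2 * pi * (K' * r powr (\<rho> - 1 / 2 + \<eta>))" by (simp add: K'_def)
    finally show ?case by simp
  qed
  moreover have "K' \<ge> 0" unfolding K'_def using K1(1) K2(1) by simp
  ultimately show ?thesis using that by blast
qed

lemma sum_ln_plus_le:
  fixes y :: "nat \<Rightarrow> complex"
  assumes "q \<ge> 1" "inj_on y {1..q}"
  obtains C where "\<And>w. \<exists>m\<in>{1..q}. (\<Sum>n=1..q. ln_plus (1 / cmod (w - y n))) \<le> C + ln_plus (1 / cmod (w - y m))"
proof -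
  \<comment> \<open>Two targets cannot both lie within half their least distance of
    \<open>w\<close>. The element 1 keeps \<open>S\<close> nonempty for \<open>q = 1\<close>, when
    there are no pairs.\<close>
  define S where "S = insert 1 ((\<lambda>(n, m). cmod (y n - y m)) ` ({1..q} \<times> {1..q} - Id))"
  define \<delta> where "\<delta> = Min S"
  have S: "finite S" "S \<noteq> {}" by (auto simp: S_def)
  have pos: "x > 0" if "x \<in> S" for x
    using that inj_onD[OF assms(2)] by (auto simp: S_def)
  have \<delta>: "\<delta> > 0" unfolding \<delta>_def by (rule pos[OF Min_in[OF S]])
  have sep: "\<delta> \<le> cmod (y n - y m)" if "n \<in> {1..q}" "m \<in> {1..q}" "n \<noteq> m" for n m
  proof -
    have "(n, m) \<in> {1..q} \<times> {1..q} - Id" using that by simp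
    hence "cmod (y n - y m) \<in> S" unfolding S_def
      by (intro insertI2 image_eqI[where x = "(n, m)"]) auto
    thus ?thesis unfolding \<delta>_def by (rule Min_le[OF S(1)])
  qed
  define L where "L = ln_plus (2 / \<delta>)"
  have far: "ln_plus (1 / cmod (w - y n)) \<le> L" if "cmod (w - y n) \<ge> \<delta> / 2" for w n
  proof -
    have "1 / cmod (w - y n) \<le> 1 / (\<delta> / 2)" using that \<delta> by (intro divide_left_mono mult_pos_pos) auto
    thus ?thesis unfolding L_def by (intro ln_plus_mono) simp
  qed
  have L0: "L \<ge> 0" by (simp add: L_def)
  show ?thesis
  proof (rule that[of "real q * L"])
    fix w
    show "\<exists>m\<in>{1..q}. (\<Sum>n=1..q. ln_plus (1 / cmod (w - y n))) \<le> real q * L + ln_plus (1 / cmod (w - y m))"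
    proof -
      obtain m where m: "m \<in> {1..q}" "\<And>n. n \<in> {1..q} \<Longrightarrow> n \<noteq> m \<Longrightarrow> cmod (w - y n) \<ge> \<delta> / 2"
      proof (cases "\<exists>m\<in>{1..q}. cmod (w - y m) < \<delta> / 2")
        case True
        then obtain m where m: "m \<in> {1..q}" "cmod (w - y m) < \<delta> / 2" by blast
        show ?thesis
        proof (rule that[OF m(1)])
          fix n assume n: "n \<in> {1..q}" "n \<noteq> m"
          have "cmod (y n - y m) \<le> cmod (w - y m) + cmod (w - y n)"
            using norm_triangle_ineq4[of "w - y m" "w - y n"] by simp
          thus "cmod (w - y n) \<ge> \<delta> / 2" using sep[OF n(1) m(1) n(2)] m(2) by linarith
        qed
      next
        case False
        \<comment> \<open>If \<open>w\<close> is near none of the targets, any index will do;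
          \<open>q \<ge> 1\<close> provides one.\<close>
        have "1 \<in> {1..q}" using assms(1) by simp
        moreover have "cmod (w - y n) \<ge> \<delta> / 2" if "n \<in> {1..q}" for n using False that by force
        ultimately show ?thesis using that by blast
      qed
      have "(\<Sum>n=1..q. ln_plus (1 / cmod (w - y n))) = ln_plus (1 / cmod (w - y m)) + (\<Sum>n\<in>{1..q} - {m}. ln_plus (1 / cmod (w - y n)))"
        using m(1) by (intro sum.remove) auto
      moreover have "(\<Sum>n\<in>{1..q} - {m}. ln_plus (1 / cmod (w - y n))) \<le> (\<Sum>n\<in>{1..q} - {m}. L)"
        using m(2) by (intro sum_mono far) auto
      moreover have "(\<Sum>n\<in>{1..q} - {m}. L) \<le> (\<Sum>n\<in>{1..q}. L)"
        using L0 by (intro sum_mono2) auto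
      moreover have "(\<Sum>n\<in>{1..q}. L) = real q * L" by simp
      ultimately have "(\<Sum>n=1..q. ln_plus (1 / cmod (w - y n))) \<le> real q * L + ln_plus (1 / cmod (w - y m))"
        by linarith
      thus ?thesis using m(1) by blast
    qed
  qed
qed

theorem theorem3p1:
  fixes f :: "complex \<Rightarrow> complex" and \<sigma> \<epsilon> :: real and q :: nat and y :: "nat \<Rightarrow> complex"
  assumes "f meromorphic_on UNIV"
    and "growth_order f = ereal \<sigma>"
    and "f \<notin> wilson_kernel"
    and "q \<ge> 1"
    and "inj_on y {1..q}"
    and "\<epsilon> > 0"
  shows "\<exists>g h :: real \<Rightarrow> real.
           g \<in> O[at_top](\<lambda>r. r powr (\<sigma> - 1 / 2 + \<epsilon>)) \<and> h \<in> O[at_top](\<lambda>_. 1) \<and>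
           (\<forall>\<^sub>F r in at_top.
              proximity r f + (\<Sum>n=1..q. proximity r (\<lambda>x. 1 / (f x - y n)))
                \<le> 2 * nevanlinna_char r f - wilson_ramification r f + g r + h r)"
proof -
  define D where "D = wilson f"
  have D: "nonzero_meromorphic D" unfolding D_def by (rule nonzero_meromorphic_wilson[OF assms(1,3)])
  have fc: "nonzero_meromorphic (\<lambda>x. f x - c)" for c by (rule nonzero_meromorphic_diff_const[OF assms(1,3)])
  have f: "nonzero_meromorphic f" using fc[of 0] by simp
  have fi: "nonzero_meromorphic (\<lambda>x. 1 / (f x - c))" for c by (rule nonzero_meromorphic_inverse(1)[OF fc])
  have Di: "nonzero_meromorphic (\<lambda>x. 1 / D x)" by (rule nonzero_meromorphic_inverse(1)[OF D])
  have Df: "nonzero_meromorphic (\<lambda>x. D x / (f x - c))" for c by (rule nonzero_meromorphic_divide[OF D fc])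
  have \<sigma>: "\<sigma> \<ge> 0" by (rule growth_order_bounds(1)[OF assms(2)])
  \<comment> \<open>The loss \<open>\<eta>\<close> is incurred twice, in the growth bound
    \<open>r powr (\<sigma> + \<eta>)\<close> and in the exponent of the singular integrals, hence
    \<open>2 * \<eta> \<le> \<epsilon>\<close>; the cap ensures
    \<open>\<eta> < 1 / 2\<close>.\<close>
  define \<eta> where "\<eta> = min \<epsilon> (1 / 2) / 2"
  have \<eta>: "0 < \<eta>" "\<eta> < 1 / 2" "2 * \<eta> \<le> \<epsilon>" using assms(6) by (auto simp: \<eta>_def)
  have small: "\<exists>K\<ge>0. \<forall>\<^sub>F r in at_top. proximity r (\<lambda>x. D x / (f x - c)) \<le> K * r powr (\<sigma> - 1 / 2 + \<epsilon>)" for c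
  proof -
    define C where "C = ln_plus (cmod c) + ln 2"
    have C: "C \<ge> 0" by (simp add: C_def)
    have T: "\<forall>\<^sub>F r in at_top. nevanlinna_char r (\<lambda>x. f x - c) \<le> (1 + C) * r powr (\<sigma> + \<eta>)"
      using growth_order_bounds(2)[OF assms(2) \<eta>(1)] eventually_ge_at_top[of 1]
    proof eventually_elim
      case (elim r)
      have "1 \<le> r powr (\<sigma> + \<eta>)" using elim \<sigma> \<eta> by (intro ge_one_powr_ge_zero) auto
      hence "C \<le> C * r powr (\<sigma> + \<eta>)" using C mult_left_mono[of 1 "r powr (\<sigma> + \<eta>)" C] by simp
      moreover have "nevanlinna_char r (\<lambda>x. f x - c) \<le> nevanlinna_char r f + C"
        unfolding C_def using elim by (intro nevanlinna_char_diff_const f fc) auto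
      ultimately show ?case using elim by (simp add: distrib_right)
    qed
    have W: "wilson (\<lambda>x. f x - c) = D" unfolding D_def by (rule wilson_diff_const)
    have "\<sigma> + \<eta> \<ge> 0" "1 + C \<ge> 0" using \<sigma> \<eta> C by auto
    then obtain K where K: "K \<ge> 0"
      "\<forall>\<^sub>F r in at_top. proximity r (\<lambda>x. D x / (f x - c)) \<le> K * r powr (\<sigma> + \<eta> - 1 / 2 + \<eta>)"
      using wilson_log_difference[OF fc[of c], unfolded W, OF D _ _ T \<eta>(1,2)] by blast
    have "\<forall>\<^sub>F r in at_top. proximity r (\<lambda>x. D x / (f x - c)) \<le> K * r powr (\<sigma> - 1 / 2 + \<epsilon>)"
      using K(2) eventually_ge_at_top[of 1]
    proof eventually_elim
      case (elim r)
      have "r powr (\<sigma> + \<eta> - 1 / 2 + \<eta>) \<le> r powr (\<sigma> - 1 / 2 + \<epsilon>)"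
        using elim \<eta> by (intro powr_mono) auto
      hence "K * r powr (\<sigma> + \<eta> - 1 / 2 + \<eta>) \<le> K * r powr (\<sigma> - 1 / 2 + \<epsilon>)" using K(1) by (rule mult_left_mono)
      thus ?case using elim by linarith
    qed
    thus ?thesis using K(1) by blast
  qed
  then obtain K where K: "\<And>c. K c \<ge> 0"
    "\<And>c. \<forall>\<^sub>F r in at_top. proximity r (\<lambda>x. D x / (f x - c)) \<le> K c * r powr (\<sigma> - 1 / 2 + \<epsilon>)"
    by metis
  obtain C0 where C0: "\<And>w. \<exists>m\<in>{1..q}. (\<Sum>n=1..q. ln_plus (1 / cmod (w - y n))) \<le> C0 + ln_plus (1 / cmod (w - y m))"
    using sum_ln_plus_le[OF assms(4,5)] by blast
  obtain C1 where C1: "\<And>r. r \<ge> 1 \<Longrightarrow> nevanlinna_char r (\<lambda>z. 1 / D z) = nevanlinna_char r D + C1"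
    using nevanlinna_char_inverse[OF D] by blast
  \<comment> \<open>\<open>K 0\<close> pays for D/f in the bound for m(r, D), the other terms for
    the quotients with \<open>y n\<close>.\<close>
  define K' where "K' = K 0 + (\<Sum>n=1..q. K (y n))"
  have ev: "\<forall>\<^sub>F r in at_top. \<forall>n\<in>{1..q}. proximity r (\<lambda>x. D x / (f x - y n)) \<le> K (y n) * r powr (\<sigma> - 1 / 2 + \<epsilon>)"
    by (intro eventually_ball_finite ballI K) auto
  have main: "\<forall>\<^sub>F r in at_top.
              proximity r f + (\<Sum>n=1..q. proximity r (\<lambda>x. 1 / (f x - y n)))
                \<le> 2 * nevanlinna_char r f - wilson_ramification r f + K' * r powr (\<sigma> - 1 / 2 + \<epsilon>) + (C0 + C1)"
    using ev K(2)[of 0] eventually_ge_at_top[of 1]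
  proof eventually_elim
    case (elim r)
    have r: "r > 0" "r \<ge> 1" using elim by auto
    let ?w = "\<lambda>\<theta>. f (rcis r \<theta>)" and ?D = "\<lambda>\<theta>. D (rcis r \<theta>)"
    have 1: "(\<Sum>n=1..q. proximity r (\<lambda>x. 1 / (f x - y n))) \<le>
        C0 + (\<Sum>n=1..q. proximity r (\<lambda>x. D x / (f x - y n))) + proximity r (\<lambda>x. 1 / D x)"
    proof -
      have "2 * pi * (\<Sum>n=1..q. proximity r (\<lambda>x. 1 / (f x - y n))) =
         (LINT \<theta>|angles. (\<Sum>n=1..q. ln_plus (cmod (1 / (?w \<theta> - y n)))))"
        unfolding sum_distrib_left circle_ln_plus(2)[OF fi r(1)]
        by (rule Bochner_Integration.integral_sum [symmetric]) (rule circle_ln_plus(1)[OF fi r(1)])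
      also have "\<dots> \<le> (LINT \<theta>|angles. C0 + (\<Sum>n=1..q. ln_plus (cmod (?D \<theta> / (?w \<theta> - y n)))) + ln_plus (cmod (1 / ?D \<theta>)))"
      proof (intro integral_mono_AE Bochner_Integration.integrable_add Bochner_Integration.integrable_sum
          circle_ln_plus(1)[OF fi r(1)] circle_ln_plus(1)[OF Df r(1)] circle_ln_plus(1)[OF Di r(1)] integrable_angles_const)
        show "AE \<theta> in angles. (\<Sum>n=1..q. ln_plus (cmod (1 / (?w \<theta> - y n)))) \<le>
           C0 + (\<Sum>n=1..q. ln_plus (cmod (?D \<theta> / (?w \<theta> - y n)))) + ln_plus (cmod (1 / ?D \<theta>))"
          using AE_rcis_cosparse[OF r(1) nonzero_meromorphicD(6)[OF D]]
        proof eventually_elim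
          case (elim \<theta>)
          obtain m where m: "m \<in> {1..q}"
            "(\<Sum>n=1..q. ln_plus (1 / cmod (?w \<theta> - y n))) \<le> C0 + ln_plus (1 / cmod (?w \<theta> - y m))"
            using C0 by blast
          \<comment> \<open>This includes the case that \<open>f\<close> takes the value
            \<open>y m\<close>: both sides are then 0, as division by 0 gives 0.\<close>
          have "1 / cmod (?w \<theta> - y m) = cmod (?D \<theta> / (?w \<theta> - y m)) * cmod (1 / ?D \<theta>)"
            using elim by (simp add: norm_divide)
          also have "ln_plus \<dots> \<le> ln_plus (cmod (?D \<theta> / (?w \<theta> - y m))) + ln_plus (cmod (1 / ?D \<theta>))"
            by (rule ln_plus_mult) auto
          finally have "ln_plus (1 / cmod (?w \<theta> - y m)) \<le> \<dots>" .
          moreover have "ln_plus (cmod (?D \<theta> / (?w \<theta> - y m))) \<le> (\<Sum>n=1..q. ln_plus (cmod (?D \<theta> / (?w \<theta> - y n))))"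
            using m(1) by (intro member_le_sum) auto
          moreover have "(\<Sum>n=1..q. ln_plus (cmod (1 / (?w \<theta> - y n)))) = (\<Sum>n=1..q. ln_plus (1 / cmod (?w \<theta> - y n)))"
            by (simp add: norm_divide)
          ultimately show ?case using m(2) by linarith
        qed
      qed
      also have "\<dots> = 2 * pi * (C0 + (\<Sum>n=1..q. proximity r (\<lambda>x. D x / (f x - y n))) + proximity r (\<lambda>x. 1 / D x))"
        unfolding distrib_left sum_distrib_left circle_ln_plus(2)[OF Df r(1)] circle_ln_plus(2)[OF Di r(1)]
        using circle_ln_plus(1)[OF Df r(1)] circle_ln_plus(1)[OF Di r(1)]
        by (simp only: Bochner_Integration.integral_add Bochner_Integration.integral_sum
            Bochner_Integration.integrable_add Bochner_Integration.integrable_sum integrable_angles_const integral_angles_const)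
      finally show ?thesis by simp
    qed
    \<comment> \<open>The form \<open>f x - 0\<close> makes this the case \<open>c = 0\<close> of
      \<open>Df\<close> and \<open>K\<close>.\<close>
    have 2: "proximity r D \<le> proximity r f + proximity r (\<lambda>x. D x / (f x - 0))"
    proof -
      have "2 * pi * proximity r D = (LINT \<theta>|angles. ln_plus (cmod (?D \<theta>)))"
        by (rule circle_ln_plus(2)[OF D r(1)])
      also have "\<dots> \<le> (LINT \<theta>|angles. ln_plus (cmod (?w \<theta>)) + ln_plus (cmod (?D \<theta> / (?w \<theta> - 0))))"
      proof (intro integral_mono_AE Bochner_Integration.integrable_add
          circle_ln_plus(1)[OF f r(1)] circle_ln_plus(1)[OF Df r(1)] circle_ln_plus(1)[OF D r(1)])
        show "AE \<theta> in angles. ln_plus (cmod (?D \<theta>)) \<le> ln_plus (cmod (?w \<theta>)) + ln_plus (cmod (?D \<theta> / (?w \<theta> - 0)))"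
          using AE_rcis_cosparse[OF r(1) nonzero_meromorphicD(6)[OF f]]
        proof eventually_elim
          case (elim \<theta>)
          have "cmod (?D \<theta>) = cmod (?w \<theta>) * cmod (?D \<theta> / (?w \<theta> - 0))"
            using elim by (simp add: norm_divide)
          also have "ln_plus \<dots> \<le> ln_plus (cmod (?w \<theta>)) + ln_plus (cmod (?D \<theta> / (?w \<theta> - 0)))"
            by (rule ln_plus_mult) auto
          finally show ?case .
        qed
      qed
      also have "\<dots> = 2 * pi * (proximity r f + proximity r (\<lambda>x. D x / (f x - 0)))"
        unfolding distrib_left circle_ln_plus(2)[OF Df r(1)] circle_ln_plus(2)[OF f r(1)]
        by (rule Bochner_Integration.integral_add[OF circle_ln_plus(1)[OF f r(1)] circle_ln_plus(1)[OF Df r(1)]])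
      finally show ?thesis by simp
    qed
    have 3: "(\<Sum>n=1..q. proximity r (\<lambda>x. D x / (f x - y n))) \<le> (\<Sum>n=1..q. K (y n) * r powr (\<sigma> - 1 / 2 + \<epsilon>))"
      using elim by (intro sum_mono) auto
    have 4: "K' * r powr (\<sigma> - 1 / 2 + \<epsilon>) = K 0 * r powr (\<sigma> - 1 / 2 + \<epsilon>) + (\<Sum>n=1..q. K (y n) * r powr (\<sigma> - 1 / 2 + \<epsilon>))"
      by (simp add: K'_def distrib_right sum_distrib_right)
    let ?N = "\<lambda>g. integrated_pole_count r g"
    \<comment> \<open>The first fundamental theorem for \<open>D\<close>, solved for m(r, 1/D); it
      supplies the two counting functions of \<open>D\<close> in the ramification term.\<close>
    have "proximity r (\<lambda>x. 1 / D x) = proximity r D + ?N D + C1 - ?N (\<lambda>x. 1 / D x)"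
      using C1[OF r(2)] by (simp add: nevanlinna_char_def)
    moreover have "proximity r D \<le> proximity r f + K 0 * r powr (\<sigma> - 1 / 2 + \<epsilon>)"
      using 2 elim(2) by (rule order_trans[OF _ add_left_mono])
    ultimately have "(\<Sum>n=1..q. proximity r (\<lambda>x. 1 / (f x - y n))) \<le>
        C0 + K' * r powr (\<sigma> - 1 / 2 + \<epsilon>) + proximity r f + ?N D + C1 - ?N (\<lambda>x. 1 / D x)"
      using 1 3 4 by simp
    \<comment> \<open>In 2T(r, f) minus the ramification term the copies of N(r, f) cancel, leaving
      2m(r, f) - N(r, 1/D) + N(r, D). One m(r, f) matches the left side, the other comes from
      bounding m(r, D).\<close>
    thus ?case
      by (simp add: nevanlinna_char_def wilson_ramification_def D_def)
  qed
  show ?thesis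
  proof (intro exI conjI)
    show "(\<lambda>r. K' * r powr (\<sigma> - 1 / 2 + \<epsilon>)) \<in> O[at_top](\<lambda>r. r powr (\<sigma> - 1 / 2 + \<epsilon>))" by simp
    show "(\<lambda>_. C0 + C1) \<in> O[at_top](\<lambda>_. 1)" by simp
  qed (rule main)
qed

end
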